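(* Fix the number of resources $d\ge 1$ and a constant $\sigma>0$. Consider, for each horizon $T$, an instance of the online resource allocation problem with $T$ items, $d$ resources, capacities $b_k$ and item distribution $\mathcal{D}$ (these, and the number of supply nodes, may depend on $T$), and define $$B=B_T=\min_{k\in\mathcal{K}}\left\{\frac{b_k}{\max_{t\in\{1,\dots,T\},\,j\in\mathcal{J}}A^t_{jk}}\right\},$$ where the maximum is over all values $A^t_{jk}$ in the support of $\mathcal{D}$. If $B=\Omega(\log^{1+\sigma}T)$ as $T\to\infty$, then single-sample OSO, run with an equivariant solver, is asymptotically optimal: there exist $\varepsilon_T\to 0$ as $T\to\infty$ such that $$\mathbb{E}\Big[\sum_{t=1}^T r^t\cdot\overline x^t\Big]\ge(1-\varepsilon_T)\,\mathbb{E}[\mathrm{OPT}]\quad\text{for all sufficiently large } T.$$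
   Context: Online resource allocation problem. There are $m$ supply nodes ($j\in\mathcal{J}=\{1,\dots,m\}$) and $d$ resources ($k\in\mathcal{K}=\{1,\dots,d\}$); resource $k$ has deterministic capacity $b_k\ge 0$, and $b=(b_1,\dots,b_d)$. Items $t=1,\dots,T$ arrive one at a time. Item $t$ is described by $\xi^t=(r^t,A^t)$, where $r^t\in\mathbb{R}^m$ is a vector of rewards and $A^t\in\mathbb{R}_{\ge 0}^{m\times d}$ is a matrix of resource consumptions. The $\xi^1,\dots,\xi^T$ are i.i.d. from a known distribution $\mathcal{D}$ (with integrable rewards). Let $\Delta=\{x\in\{0,1\}^m:\sum_{j}x_j\le 1\}$. The perfect-information optimum is the random variable $$\mathrm{OPT}=\max\Big\{\sum_{t=1}^T r^t\cdot x^t\;:\;\sum_{t=1}^T (A^t)^\top x^t\le b,\; x^1,\dots,x^T\in\Delta\Big\}.$$ Single-sample OSO algorithm. For $t=1,\dots,T$: observe $\xi^t$; draw one fresh sample path $\widetilde\xi^{t+1}_t,\dots,\widetilde\xi^{T}_t$, with $\widetilde\xi^\tau_t=(\widetilde r^\tau_t,\widetilde A^\tau_t)$, i.i.d. from $\mathcal{D}$ and independent of everything else; use the solver to compute an optimal solution $(\widetilde x^t,\dots,\widetilde x^T)$ of $$\max\Big\{ r^t\cdot x^t+\sum_{\tau=t+1}^T \widetilde r^\tau_t\cdot x^\tau : \sum_{\tau=1}^{t-1}(A^\tau)^\top\overline x^\tau+(A^t)^\top x^t+\sum_{\tau=t+1}^T(\widetilde A^\tau_t)^\top x^\tau\le b,\;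 x^t,\dots,x^T\in\Delta\Big\};$$ implement $\overline x^t=\widetilde x^t$ irrevocably and discard the rest. Equivariant solver. An exact solver for integer programs $\max\{\sum_{i=1}^s r^i\cdot x^i:\sum_{i=1}^s (A^i)^\top x^i\le b',\,x^i\in\Delta\}$ is equivariant if permuting the items permutes the solution in the same way: if it returns $(x^1,\dots,x^s)$ on the list of items $(r^1,A^1),\dots,(r^s,A^s)$, then for every permutation $\pi$ of $\{1,\dots,s\}$ it returns $(x^{\pi(1)},\dots,x^{\pi(s)})$ on the list $(r^{\pi(1)},A^{\pi(1)}),\dots,(r^{\pi(s)},A^{\pi(s)})$. The solver may use internal randomness (fresh and independent at each call, e.g. to break ties between identical items), in which case this is understood as equality in distribution. A ratio $b_k/0$ in the definition of $B$ is read as $+\infty$. *)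

theory Defs
  imports "HOL-Probability.Probability" "HOL-Combinatorics.Permutations"
begin

text \<open>
  Resources are indexed by a finite type \<open>'d\<close>. The number \<open>m\<close> of supply nodes varies with the
  horizon, so it is an explicit parameter: supply nodes are the naturals below \<open>m\<close>, and a vector
  over them is a function on \<open>nat\<close> that vanishes from \<open>m\<close> on. This identifies
  \<open>\<real>\<^sup>m \<times> \<real>\<^sup>m\<^sup>\<times>\<^sup>d\<close> with a closed subset of the item type, with the same topology and Borel sets.
  Periods are numbered from 0.
\<close>

type_synonym 'd item = "(nat \<Rightarrow> real) \<times> (nat \<Rightarrow> real ^ 'd)"

type_synonym decision = "nat \<Rightarrow> real"

definition items :: "nat \<Rightarrow> ('d::finite) item set" where
  "items m = {(r, A). (\<forall>j\<ge>m. r j = 0 \<and> A j = 0) \<and> (\<forall>j<m. \<forall>k. 0 \<le> A j $ k)}"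

definition item_space :: "nat \<Rightarrow> ('d::finite) item measure" where
  "item_space m = restrict_space borel (items m)"

definition Delta :: "nat \<Rightarrow> decision set" where
  "Delta m = {x. (\<forall>j. x j \<in> {0, 1}) \<and> (\<forall>j\<ge>m. x j = 0) \<and> (\<Sum>j<m. x j) \<le> 1}"

definition reward :: "nat \<Rightarrow> ('d::finite) item \<Rightarrow> decision \<Rightarrow> real" where
  "reward m \<xi> x = (\<Sum>j<m. fst \<xi> j * x j)"

definition consumption :: "nat \<Rightarrow> ('d::finite) item \<Rightarrow> decision \<Rightarrow> real ^ 'd" where
  "consumption m \<xi> x = (\<chi> k. \<Sum>j<m. snd \<xi> j $ k * x j)"

definition total_reward :: "nat \<Rightarrow> ('d::finite) item list \<Rightarrow> decision list \<Rightarrow> real" where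
  "total_reward m \<xi>s xs = (\<Sum>i<length \<xi>s. reward m (\<xi>s ! i) (xs ! i))"

definition feasible :: "nat \<Rightarrow> real ^ 'd \<Rightarrow> ('d::finite) item list \<Rightarrow> decision list set" where
  "feasible m c \<xi>s = {xs. length xs = length \<xi>s \<and> set xs \<subseteq> Delta m \<and>
     (\<forall>k. (\<Sum>i<length \<xi>s. consumption m (\<xi>s ! i) (xs ! i)) $ k \<le> c $ k)}"

definition optimal :: "nat \<Rightarrow> real ^ 'd \<Rightarrow> ('d::finite) item list \<Rightarrow> decision list set" where
  "optimal m c \<xi>s = {xs \<in> feasible m c \<xi>s.
     \<forall>ys \<in> feasible m c \<xi>s. total_reward m \<xi>s ys \<le> total_reward m \<xi>s xs}"

definition OPT :: "nat \<Rightarrow> real ^ 'd \<Rightarrow> ('d::finite) item list \<Rightarrow> real" where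
  "OPT m c \<xi>s = Max (total_reward m \<xi>s ` feasible m c \<xi>s)"

definition capacities :: "(real ^ 'd::finite) set" where
  "capacities = {c. \<forall>k. 0 \<le> c $ k}"

text \<open>
  A solver maps the number of supply nodes, a capacity vector, a list of items and a random seed to
  a list of decisions; \<open>U\<close> is the law of the seed, and a deterministic solver is one that ignores
  the seed. Requirements are imposed only for nonnegative capacities, since the integer program
  is infeasible otherwise. Measurability in (capacity, items, seed), with solutions as discrete
  outcomes, makes the decisions of the online algorithm random variables. Equivariance of a
  seeded solver is equality in distribution over the seed.
\<close>

type_synonym ('d, 'u) solver =
  "nat \<Rightarrow> real ^ 'd \<Rightarrow> 'd item list \<Rightarrow> 'u \<Rightarrow> decision list"

definition exact_solver :: "'u measure \<Rightarrow> ('d::finite, 'u) solver \<Rightarrow> bool" where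
  "exact_solver U sol \<longleftrightarrow> prob_space U \<and>
     (\<forall>m s. (\<lambda>(c, \<xi>, u). sol m c (map \<xi> [0..<s]) u) \<in>
        restrict_space borel capacities \<Otimes>\<^sub>M (\<Pi>\<^sub>M i\<in>{..<s}. item_space m) \<Otimes>\<^sub>M U
          \<rightarrow>\<^sub>M count_space UNIV) \<and>
     (\<forall>m. \<forall>c\<in>capacities. \<forall>\<xi>s. set \<xi>s \<subseteq> items m \<longrightarrow>
        (\<forall>u\<in>space U. sol m c \<xi>s u \<in> optimal m c \<xi>s))"

definition equivariant :: "'u measure \<Rightarrow> ('d::finite, 'u) solver \<Rightarrow> bool" where
  "equivariant U sol \<longleftrightarrow>
     (\<forall>m. \<forall>c\<in>capacities. \<forall>\<xi>s p. set \<xi>s \<subseteq> items m \<longrightarrow> p permutes {..<length \<xi>s} \<longrightarrow>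
        distr U (count_space UNIV) (sol m c (permute_list p \<xi>s)) =
        distr U (count_space UNIV) (\<lambda>u. permute_list p (sol m c \<xi>s u)))"

definition allocation_instance ::
    "nat \<Rightarrow> real ^ 'd \<Rightarrow> ('d::finite) item measure \<Rightarrow> bool" where
  "allocation_instance m b D \<longleftrightarrow> 1 \<le> m \<and> (\<forall>k. 0 \<le> b $ k) \<and> prob_space D \<and>
     sets D = sets (item_space m) \<and> (\<forall>j<m. integrable D (\<lambda>\<xi>. fst \<xi> j))"

definition support :: "('d::finite) item measure \<Rightarrow> 'd item set" where
  "support D = {\<xi> \<in> space D. \<forall>V. open V \<longrightarrow> \<xi> \<in> V \<longrightarrow> 0 < measure D (V \<inter> space D)}"

definition max_consumption :: "nat \<Rightarrow> ('d::finite) item measure \<Rightarrow> 'd \<Rightarrow> ereal" where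
  "max_consumption m D k = (SUP \<xi>\<in>support D. SUP j\<in>{..<m}. ereal (snd \<xi> j $ k))"

text \<open>
  The case distinction is needed because \<open>0 / 0 = 0\<close> in \<^typ>\<open>ereal\<close>, while here every ratio with
  zero denominator is infinite. For unbounded support the ratio is \<open>b / \<infinity> = 0\<close>.
\<close>

definition capacity_scale :: "nat \<Rightarrow> real ^ 'd \<Rightarrow> ('d::finite) item measure \<Rightarrow> ereal" where
  "capacity_scale m b D = Min (range (\<lambda>k.
     if max_consumption m D k = 0 then \<infinity> else ereal (b $ k) / max_consumption m D k))"

text \<open>
  \<open>oso sol m b T \<xi> \<zeta> u t\<close> lists the decisions of single-sample OSO in the first \<open>t\<close> periods of
  horizon \<open>T\<close>, where \<open>\<xi> t\<close> is the item arriving in period \<open>t\<close>, \<open>\<zeta> (t, \<tau>)\<close> is the item sampled in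
  period \<open>t\<close> for the later period \<open>\<tau>\<close>, and \<open>u t\<close> is the seed of the solver call in period \<open>t\<close>.
\<close>

primrec oso :: "('d::finite, 'u) solver \<Rightarrow> nat \<Rightarrow> real ^ 'd \<Rightarrow> nat \<Rightarrow> (nat \<Rightarrow> 'd item) \<Rightarrow>
    (nat \<times> nat \<Rightarrow> 'd item) \<Rightarrow> (nat \<Rightarrow> 'u) \<Rightarrow> nat \<Rightarrow> decision list" where
  "oso sol m b T \<xi> \<zeta> u 0 = []"
| "oso sol m b T \<xi> \<zeta> u (Suc t) =
     (let xs = oso sol m b T \<xi> \<zeta> u t;
          c = b - (\<Sum>\<tau><t. consumption m (\<xi> \<tau>) (xs ! \<tau>))
      in xs @ [hd (sol m c (\<xi> t # map (\<lambda>\<tau>. \<zeta> (t, \<tau>)) [Suc t..<T]) (u t))])"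

definition expected_OPT :: "nat \<Rightarrow> real ^ 'd \<Rightarrow> ('d::finite) item measure \<Rightarrow> nat \<Rightarrow> real" where
  "expected_OPT m b D T =
     (\<integral>\<xi>. OPT m b (map \<xi> [0..<T]) \<partial>(\<Pi>\<^sub>M t\<in>{..<T}. D))"

definition expected_OSO :: "'u measure \<Rightarrow> ('d::finite, 'u) solver \<Rightarrow>
    nat \<Rightarrow> real ^ 'd \<Rightarrow> 'd item measure \<Rightarrow> nat \<Rightarrow> real" where
  "expected_OSO U sol m b D T =
     (\<integral>(\<xi>, \<zeta>, u). total_reward m (map \<xi> [0..<T]) (oso sol m b T \<xi> \<zeta> u T)
        \<partial>((\<Pi>\<^sub>M t\<in>{..<T}. D) \<Otimes>\<^sub>M (\<Pi>\<^sub>M p\<in>{(t, \<tau>). t < \<tau> \<and> \<tau> < T}. D) \<Otimes>\<^sub>M (\<Pi>\<^sub>M t\<in>{..<T}. U)))"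

end

theory Submission
  imports Defs
begin

text \<open>
Let \<open>V\<^sub>s(c)\<close> be the expected offline optimum of \<open>s\<close> i.i.d. items with capacity \<open>c\<close>. The proof
compares every period with the offline benchmark \<open>V\<^sub>T(b)\<close>.

A single period is exactly fair. When \<open>s\<close> items, the current one included, are still to be served
and the remaining capacity is \<open>c\<close>, the solver is called on the current item and \<open>s - 1\<close> samples.
Given the past these are \<open>s\<close> i.i.d. items, and an equivariant solver treats them alike. So the
current item collects in expectation the fraction \<open>1/s\<close> of the value of the solution, which is
\<open>V\<^sub>s(c)/s\<close> (\<open>expected_gain\<close>), and it consumes in expectation at most \<open>c/s\<close> (\<open>expected_use\<close>).
That the fresh items are independent of the past is \<open>splits_period\<close>.

Capacity is not exhausted early. By the bound on consumption, the remaining capacity per remaining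
period is a submartingale. Its increments are small, because an item uses at most the fraction
\<open>1/N\<close> of each capacity, where \<open>N\<close> is a lower bound on the scale \<open>B\<close>. A second-moment estimate for the
downward deviation (\<open>shortfall_le\<close>) and Markov's inequality show that, as long as at least \<open>\<delta>T\<close>
periods remain, \<open>c \<ge> (1 - \<delta>)(s/T)b\<close> fails for a given resource with probability at most
\<open>1/(N\<delta>\<^sup>4)\<close> (\<open>prob_low_capacity\<close>).

With that much capacity, \<open>s\<close> items are worth almost \<open>s/T\<close> times the benchmark. Keep every item of
an optimal solution of the \<open>T\<close>-item problem with probability \<open>q = (1 - 2\<delta>)s/T\<close>, independently. By
Chebyshev's inequality the kept items number at most \<open>s\<close> and respect \<open>(1 - \<delta>)(s/T)b\<close> with high
probability, even when conditioned on keeping a given item, so the kept value is at least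
\<open>q (1 - (d + 1)/(N\<delta>\<^sup>4))\<close> times the optimum (\<open>OPT_thin\<close>, \<open>V_thin\<close>).

Summing \<open>V\<^sub>s(c)/s\<close> over all but the last \<open>\<delta>T\<close> periods gives the ratio
\<open>1 - 3\<delta> - 2(d + 1)/(N\<delta>\<^sup>4)\<close> at every horizon (\<open>competitive_ratio\<close>). The choice
\<open>\<delta> = N\<^sup>-\<^sup>1\<^sup>/\<^sup>5\<close> makes the loss \<open>(2d + 5) N\<^sup>-\<^sup>1\<^sup>/\<^sup>5\<close>, which vanishes because
\<open>N = min (c ln\<^sup>1\<^sup>+\<^sup>\<sigma> T) T\<close> tends to infinity.
\<close>

section \<open>Random subsets\<close>

text \<open>
The expectation of \<open>f\<close> at a random subset of \<open>I\<close> that contains every element independently with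
probability \<open>q\<close>. A finite sum suffices, and it moves freely past integrals over the items.
\<close>

definition thin :: "real \<Rightarrow> 'a set \<Rightarrow> ('a set \<Rightarrow> real) \<Rightarrow> real" where
  "thin q I f = (\<Sum>S\<in>Pow I. (\<Prod>i\<in>I. if i \<in> S then q else 1 - q) * f S)"

lemma thin_empty: "thin q {} f = f {}"
  by (simp add: thin_def)

text \<open>
Conditioning on whether \<open>i\<close> is kept; all moments below follow from this recursion.
\<close>

lemma thin_insert:
  assumes "finite I" "i \<notin> I"
  shows "thin q (insert i I) f = q * thin q I (\<lambda>S. f (insert i S)) + (1 - q) * thin q I f"
proof -
  let ?w = "\<lambda>I S. \<Prod>j\<in>I. if j \<in> S then q else 1 - q"
  have inj: "inj_on (insert i) (Pow I)"
    using assms by (intro inj_onI) (metis Pow_iff insert_ident subsetD)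
  have disj: "Pow I \<inter> insert i ` Pow I = {}"
    using assms by auto
  have w1: "?w (insert i I) S = (1 - q) * ?w I S" if "S \<subseteq> I" for S
    using assms that by auto
  have w2: "?w (insert i I) (insert i S) = q * ?w I S" if "S \<subseteq> I" for S
  proof -
    have "(\<Prod>j\<in>I. if j \<in> insert i S then q else 1 - q) = ?w I S"
      using assms by (intro prod.cong) auto
    then show ?thesis using assms by simp
  qed
  have "thin q (insert i I) f = (\<Sum>S\<in>Pow I. ?w (insert i I) S * f S) +
      (\<Sum>S\<in>Pow I. ?w (insert i I) (insert i S) * f (insert i S))"
    unfolding thin_def Pow_insert using assms disj inj
    by (subst sum.union_disjoint) (auto simp: sum.reindex)
  also have "\<dots> = (1 - q) * thin q I f + q * thin q I (\<lambda>S. f (insert i S))"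
    unfolding thin_def sum_distrib_left
    by (intro arg_cong2[where f="(+)"] sum.cong refl) (simp_all only: Pow_iff w1 w2 mult.assoc)
  finally show ?thesis by simp
qed

lemma thin_const: "finite I \<Longrightarrow> thin q I (\<lambda>S. c) = c"
  by (induction I rule: finite_induct) (simp_all add: thin_empty thin_insert algebra_simps)

lemma thin_weight_nonneg: "0 \<le> q \<Longrightarrow> q \<le> 1 \<Longrightarrow> 0 \<le> (\<Prod>i\<in>I. if i \<in> S then q else 1 - q)" for q :: real
  by (intro prod_nonneg) auto

lemma thin_mono:
  assumes "0 \<le> q" "q \<le> 1" "\<And>S. S \<subseteq> I \<Longrightarrow> f S \<le> g S"
  shows "thin q I f \<le> thin q I g"
  unfolding thin_def using assms
  by (intro sum_mono mult_left_mono thin_weight_nonneg) auto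

lemma thin_sum: "thin q I (\<lambda>S. \<Sum>k\<in>K. f k S) = (\<Sum>k\<in>K. thin q I (f k))"
  unfolding thin_def by (subst sum.swap) (simp add: sum_distrib_left)

lemma thin_cmult: "thin q I (\<lambda>S. c * f S) = c * thin q I f"
  unfolding thin_def by (simp add: sum_distrib_left algebra_simps)

lemma thin_diff: "thin q I (\<lambda>S. f S - g S) = thin q I f - thin q I g"
  unfolding thin_def by (simp add: sum_subtractf algebra_simps)

lemma thin_add: "thin q I (\<lambda>S. f S + g S) = thin q I f + thin q I g"
  unfolding thin_def by (simp add: sum.distrib algebra_simps)

lemma thin_cong: "(\<And>S. S \<subseteq> I \<Longrightarrow> f S = g S) \<Longrightarrow> thin q I f = thin q I g"
  unfolding thin_def by (intro sum.cong) auto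

lemma thin_member:
  assumes "finite I" "i \<in> I"
  shows "thin q I (\<lambda>S. if i \<in> S then f S else 0) = q * thin q (I - {i}) (\<lambda>S. f (insert i S))"
proof -
  have I: "I = insert i (I - {i})" using assms by auto
  have "thin q (I - {i}) (\<lambda>S. if i \<in> S then f S else 0) = thin q (I - {i}) (\<lambda>S. 0)"
    by (rule thin_cong) auto
  then show ?thesis
    using assms thin_insert[of "I - {i}" i q "\<lambda>S. if i \<in> S then f S else 0"] I
    by (simp add: thin_const)
qed

text \<open>
The variance of a sum of independent terms. The offset \<open>y\<close> is what makes the induction work: the
contribution of the inserted element is absorbed into it.
\<close>

lemma thin_second_moment:
  assumes "finite I"
  shows "thin q I (\<lambda>S. ((\<Sum>i\<in>S. a i) - q * (\<Sum>i\<in>I. a i) + y)\<^sup>2) = y\<^sup>2 + q * (1 - q) * (\<Sum>i\<in>I. (a i)\<^sup>2)"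
  using assms
proof (induction I arbitrary: y rule: finite_induct)
  case empty
  then show ?case by (simp add: thin_empty)
next
  case (insert i I)
  have 1: "thin q I (\<lambda>S. ((\<Sum>j\<in>insert i S. a j) - q * (\<Sum>j\<in>insert i I. a j) + y)\<^sup>2)
     = thin q I (\<lambda>S. ((\<Sum>j\<in>S. a j) - q * (\<Sum>j\<in>I. a j) + (y + (1 - q) * a i))\<^sup>2)"
  proof (rule thin_cong)
    fix S assume "S \<subseteq> I"
    with insert have "finite S" "i \<notin> S" by (auto intro: finite_subset)
    with insert show "((\<Sum>j\<in>insert i S. a j) - q * (\<Sum>j\<in>insert i I. a j) + y)\<^sup>2 =
        ((\<Sum>j\<in>S. a j) - q * (\<Sum>j\<in>I. a j) + (y + (1 - q) * a i))\<^sup>2"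
      by (simp add: algebra_simps)
  qed
  have 2: "thin q I (\<lambda>S. ((\<Sum>j\<in>S. a j) - q * (\<Sum>j\<in>insert i I. a j) + y)\<^sup>2)
     = thin q I (\<lambda>S. ((\<Sum>j\<in>S. a j) - q * (\<Sum>j\<in>I. a j) + (y - q * a i))\<^sup>2)"
    using insert by (intro thin_cong) (simp add: algebra_simps)
  show ?case
    unfolding thin_insert[OF insert.hyps] 1 2 insert.IH
    using insert.hyps by (simp add: algebra_simps power2_eq_square)
qed

text \<open>
Chebyshev's inequality in the presence of the event \<open>i \<in> S\<close>. Conditioning on that event shifts the
centred sum by \<open>(1 - q) a i\<close> only, so its second moment is still at most the sum of the squares
\<open>(a l)\<^sup>2\<close>, which is at most \<open>C\<^sup>2 / N\<close> since no term exceeds \<open>C / N\<close>.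
\<close>

lemma thin_overflow:
  assumes I: "finite I" "i \<in> I" and q: "0 \<le> q" "q \<le> 1"
    and N: "0 < N" and th: "0 < \<theta>"
    and a: "\<And>l. l \<in> I \<Longrightarrow> 0 \<le> a l" "\<And>l. l \<in> I \<Longrightarrow> N * a l \<le> C" and C: "(\<Sum>l\<in>I. a l) \<le> C"
    and K: "(q + \<theta>) * C \<le> K"
  shows "thin q I (\<lambda>S. if i \<in> S then (if (\<Sum>l\<in>S. a l) \<le> K then 0 else 1) else 0) \<le> q / (N * \<theta>\<^sup>2)"
proof (cases "C = 0")
  case True
  have "(\<Sum>l\<in>I. a l) = 0" using a C True by (intro antisym sum_nonneg) auto
  then have a0: "a l = 0" if "l \<in> I" for l
    using a I that by (simp add: sum_nonneg_eq_0_iff)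
  have "thin q I (\<lambda>S. if i \<in> S then (if (\<Sum>l\<in>S. a l) \<le> K then 0 else 1) else 0) = thin q I (\<lambda>S. 0)"
  proof (rule thin_cong)
    fix S assume "S \<subseteq> I"
    then have "(\<Sum>l\<in>S. a l) = 0" using a0 by (intro sum.neutral) auto
    then show "(if i \<in> S then (if (\<Sum>l\<in>S. a l) \<le> K then 0 else 1) else 0) = (0::real)"
      using K True by auto
  qed
  then show ?thesis using I q N by (simp add: thin_const)
next
  case False
  have "0 \<le> (\<Sum>l\<in>I. a l)" using a by (intro sum_nonneg)
  with C False have C0: "0 < C" by linarith
  let ?J = "I - {i}"
  \<comment> \<open>For positive \<open>C\<close>, the indicator of overflow is at most \<open>dev / (\<theta> C)\<^sup>2\<close>.\<close>
  define dev where "dev S = ((\<Sum>l\<in>S. a l) - q * (\<Sum>l\<in>I. a l))\<^sup>2" for S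
  have mem: "thin q I (\<lambda>S. if i \<in> S then dev S else 0) \<le> q * (\<Sum>l\<in>I. (a l)\<^sup>2)"
  proof -
    have "thin q ?J (\<lambda>S. dev (insert i S)) =
        thin q ?J (\<lambda>S. ((\<Sum>l\<in>S. a l) - q * (\<Sum>l\<in>?J. a l) + (1 - q) * a i)\<^sup>2)"
    proof (rule thin_cong)
      fix S assume "S \<subseteq> ?J"
      then have "finite S" "i \<notin> S" using I by (auto intro: finite_subset)
      then show "dev (insert i S) = ((\<Sum>l\<in>S. a l) - q * (\<Sum>l\<in>?J. a l) + (1 - q) * a i)\<^sup>2"
        unfolding dev_def using I by (simp add: sum.remove[of I i] algebra_simps)
    qed
    also have "\<dots> = ((1 - q) * a i)\<^sup>2 + q * (1 - q) * (\<Sum>l\<in>?J. (a l)\<^sup>2)"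
      using I by (intro thin_second_moment) auto
    also have "\<dots> \<le> 1 * (a i)\<^sup>2 + 1 * (\<Sum>l\<in>?J. (a l)\<^sup>2)"
      unfolding power_mult_distrib using q
      by (intro add_mono mult_right_mono sum_nonneg power_le_one mult_le_one) auto
    also have "\<dots> = (\<Sum>l\<in>I. (a l)\<^sup>2)"
      using I by (simp add: sum.remove[of I i])
    finally show ?thesis
      using I q by (simp add: thin_member mult_left_mono)
  qed
  have sq: "N * (\<Sum>l\<in>I. (a l)\<^sup>2) \<le> C\<^sup>2"
  proof -
    have "N * (\<Sum>l\<in>I. (a l)\<^sup>2) = (\<Sum>l\<in>I. (N * a l) * a l)"
      by (simp add: sum_distrib_left power2_eq_square mult.assoc)
    also have "\<dots> \<le> (\<Sum>l\<in>I. C * a l)"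
      using a by (intro sum_mono mult_right_mono) auto
    also have "\<dots> \<le> C * C"
      using C C0 by (simp flip: sum_distrib_left)
    finally show ?thesis by (simp add: power2_eq_square)
  qed
  have "thin q I (\<lambda>S. if i \<in> S then (if (\<Sum>l\<in>S. a l) \<le> K then 0 else 1) else 0)
      \<le> thin q I (\<lambda>S. 1 / (\<theta> * C)\<^sup>2 * (if i \<in> S then dev S else 0))"
  proof (intro thin_mono q)
    fix S assume S: "S \<subseteq> I"
    have *: "(\<theta> * C)\<^sup>2 \<le> dev S" if "\<not> (\<Sum>l\<in>S. a l) \<le> K"
    proof -
      have "q * (\<Sum>l\<in>I. a l) \<le> q * C" using C q by (intro mult_left_mono)
      with that K have "\<theta> * C \<le> (\<Sum>l\<in>S. a l) - q * (\<Sum>l\<in>I. a l)"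
        by (simp add: algebra_simps)
      then show ?thesis unfolding dev_def using th C0 by (intro power_mono) auto
    qed
    have "0 \<le> dev S" unfolding dev_def by simp
    with * show "(if i \<in> S then (if (\<Sum>l\<in>S. a l) \<le> K then 0 else 1) else 0)
        \<le> 1 / (\<theta> * C)\<^sup>2 * (if i \<in> S then dev S else 0)"
      using th C0 by (auto simp: divide_simps)
  qed
  also have "\<dots> \<le> 1 / (\<theta> * C)\<^sup>2 * (q * (\<Sum>l\<in>I. (a l)\<^sup>2))"
    unfolding thin_cmult using mem by (intro mult_left_mono) auto
  also have "\<dots> \<le> 1 / (\<theta> * C)\<^sup>2 * (q * (C\<^sup>2 / N))"
    using sq N q by (intro mult_left_mono) (auto simp: field_simps)
  also have "\<dots> = q / (N * \<theta>\<^sup>2)"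
    using C0 th N by (simp add: field_simps power2_eq_square)
  finally show ?thesis .
qed

section \<open>The offline problem\<close>

lemma finite_Delta: "finite (Delta m)"
proof (rule finite_subset)
  show "Delta m \<subseteq> {x. \<forall>j. (j \<in> {..<m} \<longrightarrow> x j \<in> {0, 1::real}) \<and> (j \<notin> {..<m} \<longrightarrow> x j = 0)}"
    by (auto simp: Delta_def)
  show "finite {x. \<forall>j. (j \<in> {..<m} \<longrightarrow> x j \<in> {0, 1::real}) \<and> (j \<notin> {..<m} \<longrightarrow> x j = 0)}"
    by (rule finite_set_of_finite_funs) auto
qed

lemma Delta_cases: "x \<in> Delta m \<Longrightarrow> x j = 0 \<or> x j = 1"
  by (auto simp: Delta_def)

lemma zero_in_Delta: "(\<lambda>_. 0) \<in> Delta m"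
  by (simp add: Delta_def)

lemma finite_feasible: "finite (feasible m c \<xi>s)"
  by (rule finite_subset[OF _ finite_lists_length_eq[OF finite_Delta, of m "length \<xi>s"]])
    (auto simp: feasible_def)

lemma sum_nth_map_distinct:
  assumes "distinct l"
  shows "(\<Sum>i<length l. f (l ! i)) = (\<Sum>i\<in>set l. f i)"
  using sum.distinct_set_conv_list[OF assms, of f] by (simp add: sum_list_sum_nth atLeast0LessThan)

text \<open>
Items are addressed through a list \<open>l\<close> of distinct indices and decisions through a function on
indices, so that solutions of subproblems are obtained by restriction instead of list surgery.
\<close>

lemma feasible_map_iff:
  assumes "distinct l"
  shows "map x l \<in> feasible m c (map \<xi> l) \<longleftrightarrow>
    (\<forall>i\<in>set l. x i \<in> Delta m) \<and> (\<forall>k. (\<Sum>i\<in>set l. consumption m (\<xi> i) (x i) $ k) \<le> c $ k)"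
proof -
  have "(\<Sum>i<length (map \<xi> l). consumption m (map \<xi> l ! i) (map x l ! i)) $ k =
      (\<Sum>i\<in>set l. consumption m (\<xi> i) (x i) $ k)" for k
    using sum_nth_map_distinct[OF assms, of "\<lambda>i. consumption m (\<xi> i) (x i) $ k"] by simp
  then show ?thesis unfolding feasible_def by auto
qed

lemma total_reward_map:
  assumes "distinct l"
  shows "total_reward m (map \<xi> l) (map x l) = (\<Sum>i\<in>set l. reward m (\<xi> i) (x i))"
  unfolding total_reward_def
  using sum_nth_map_distinct[OF assms, of "\<lambda>i. reward m (\<xi> i) (x i)"] by simp

lemma OPT_upper:
  assumes "distinct l" "\<And>i. i \<in> set l \<Longrightarrow> x i \<in> Delta m"
    "\<And>k. (\<Sum>i\<in>set l. consumption m (\<xi> i) (x i) $ k) \<le> c $ k"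
  shows "(\<Sum>i\<in>set l. reward m (\<xi> i) (x i)) \<le> OPT m c (map \<xi> l)"
  unfolding OPT_def total_reward_map[OF assms(1), symmetric]
  using assms by (intro Max_ge finite_imageI finite_feasible imageI) (simp add: feasible_map_iff)

lemma reward_zero [simp]: "reward m \<xi> (\<lambda>_. 0) = 0"
  by (simp add: reward_def)

lemma consumption_zero [simp]: "consumption m \<xi> (\<lambda>_. 0) = 0"
  by (simp add: consumption_def vec_eq_iff)

lemma consumption_nonneg:
  assumes "\<xi> \<in> items m" "x \<in> Delta m"
  shows "0 \<le> consumption m \<xi> x $ k"
proof -
  have "0 \<le> x j" for j using Delta_cases[OF assms(2), of j] by auto
  then show ?thesis
    using assms(1) by (auto simp: consumption_def items_def intro!: sum_nonneg mult_nonneg_nonneg)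
qed

lemma replicate_feasible:
  assumes "c \<in> capacities"
  shows "replicate (length \<xi>s) (\<lambda>_. 0) \<in> feasible m c \<xi>s"
  using assms zero_in_Delta by (auto simp: feasible_def capacities_def)

lemma OPT_nonneg:
  assumes "c \<in> capacities"
  shows "0 \<le> OPT m c \<xi>s"
proof -
  have "total_reward m \<xi>s (replicate (length \<xi>s) (\<lambda>_. 0)) \<le> OPT m c \<xi>s"
    unfolding OPT_def using replicate_feasible[OF assms]
    by (intro Max_ge finite_imageI finite_feasible) auto
  then show ?thesis by (simp add: total_reward_def)
qed

lemma optimal_total_reward:
  assumes "xs \<in> optimal m c \<xi>s"
  shows "total_reward m \<xi>s xs = OPT m c \<xi>s"
  unfolding OPT_def using assms
  by (intro Max_eqI[symmetric] finite_imageI finite_feasible) (auto simp: optimal_def)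

text \<open>
Replacing every decision of negative reward by the zero decision keeps a solution feasible, so an
optimal solution may be taken with nonnegative rewards. Thinning needs this: dropping an item must
never help.
\<close>

lemma OPT_attained:
  assumes "c \<in> capacities" and l: "distinct l"
    and \<xi>: "\<And>i. i \<in> set l \<Longrightarrow> \<xi> i \<in> items m"
  obtains x where "\<And>i. x i \<in> Delta m" "\<And>i. 0 \<le> reward m (\<xi> i) (x i)"
    "\<And>k. (\<Sum>i\<in>set l. consumption m (\<xi> i) (x i) $ k) \<le> c $ k"
    "OPT m c (map \<xi> l) = (\<Sum>i\<in>set l. reward m (\<xi> i) (x i))"
proof -
  have "OPT m c (map \<xi> l) \<in> total_reward m (map \<xi> l) ` feasible m c (map \<xi> l)"
    unfolding OPT_def using replicate_feasible[OF assms(1), of "map \<xi> l"]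
    by (intro Max_in finite_imageI finite_feasible) auto
  then obtain xs where xs: "xs \<in> feasible m c (map \<xi> l)" "OPT m c (map \<xi> l) = total_reward m (map \<xi> l) xs"
    by auto
  then have len: "length xs = length l" by (simp add: feasible_def)
  obtain y where y: "xs = map y l"
  proof -
    have "xs = map (\<lambda>i. the (map_of (zip l xs) i)) l"
      using l len by (intro nth_equalityI) (auto simp: map_of_zip_nth)
    then show ?thesis using that by blast
  qed
  define x where "x i = (if i \<in> set l \<and> 0 \<le> reward m (\<xi> i) (y i) then y i else (\<lambda>_. 0))" for i
  have y': "y i \<in> Delta m" if "i \<in> set l" for i
    using xs that by (auto simp: y feasible_map_iff[OF l])
  have x: "x i \<in> Delta m" for i
    using y' zero_in_Delta by (auto simp: x_def)
  have nonneg: "0 \<le> reward m (\<xi> i) (x i)" for i by (simp add: x_def)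
  have feas: "(\<Sum>i\<in>set l. consumption m (\<xi> i) (x i) $ k) \<le> c $ k" for k
  proof -
    have "(\<Sum>i\<in>set l. consumption m (\<xi> i) (x i) $ k) \<le> (\<Sum>i\<in>set l. consumption m (\<xi> i) (y i) $ k)"
      using \<xi> y' by (intro sum_mono) (auto simp: x_def consumption_nonneg)
    also have "\<dots> \<le> c $ k" using xs by (auto simp: y feasible_map_iff[OF l])
    finally show ?thesis .
  qed
  have "OPT m c (map \<xi> l) \<le> (\<Sum>i\<in>set l. reward m (\<xi> i) (x i))"
    unfolding xs(2) y total_reward_map[OF l] by (intro sum_mono) (auto simp: x_def)
  with OPT_upper[OF l, of x m \<xi> c] have eq: "OPT m c (map \<xi> l) = (\<Sum>i\<in>set l. reward m (\<xi> i) (x i))"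
    using x feas by (meson antisym)
  show ?thesis by (rule that[OF x nonneg feas eq])
qed

lemma OPT_mono_items:
  assumes c: "c \<in> capacities" and l: "distinct l" "distinct l'" "set l \<subseteq> set l'"
    and \<xi>: "\<And>i. i \<in> set l \<Longrightarrow> \<xi> i \<in> items m"
  shows "OPT m c (map \<xi> l) \<le> OPT m c (map \<xi> l')"
proof -
  obtain x where x: "\<And>i. x i \<in> Delta m" "\<And>i. 0 \<le> reward m (\<xi> i) (x i)"
    "\<And>k. (\<Sum>i\<in>set l. consumption m (\<xi> i) (x i) $ k) \<le> c $ k"
    "OPT m c (map \<xi> l) = (\<Sum>i\<in>set l. reward m (\<xi> i) (x i))"
    using OPT_attained[where m=m and \<xi>=\<xi>, OF c l(1) \<xi>] by blast
  define z where "z i = (if i \<in> set l then x i else (\<lambda>_. 0))" for i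
  have *: "(\<Sum>i\<in>set l'. g i (z i)) = (\<Sum>i\<in>set l. g i (x i))"
    if "\<And>i. g i (\<lambda>_. 0) = (0::real)" for g :: "_ \<Rightarrow> decision \<Rightarrow> real"
    using l(3) that by (intro sum.mono_neutral_cong_right) (auto simp: z_def)
  have "(\<Sum>i\<in>set l'. reward m (\<xi> i) (z i)) \<le> OPT m c (map \<xi> l')"
    using x zero_in_Delta *[of "\<lambda>i x. consumption m (\<xi> i) x $ _"]
    by (intro OPT_upper l) (auto simp: z_def)
  then show ?thesis using x(4) *[of "\<lambda>i x. reward m (\<xi> i) x"] by simp
qed

lemma consumption_le:
  fixes b :: "real ^ 'd::finite"
  assumes A: "\<And>j. j < m \<Longrightarrow> N * snd \<xi> j $ k \<le> b $ k" and x: "x \<in> Delta m" and b: "0 \<le> b $ k"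
  shows "N * consumption m \<xi> x $ k \<le> b $ k"
proof -
  have x0: "0 \<le> x j" for j using Delta_cases[OF x, of j] by auto
  have "N * consumption m \<xi> x $ k = (\<Sum>j<m. (N * snd \<xi> j $ k) * x j)"
    by (simp add: consumption_def sum_distrib_left mult.assoc)
  also have "\<dots> \<le> (\<Sum>j<m. b $ k * x j)"
    using A x0 by (intro sum_mono mult_right_mono) auto
  also have "\<dots> = b $ k * (\<Sum>j<m. x j)" by (simp add: sum_distrib_left)
  also have "\<dots> \<le> b $ k * 1"
    using x b by (intro mult_left_mono) (auto simp: Delta_def)
  finally show ?thesis by simp
qed

lemma reward_bound:
  assumes "x \<in> Delta m"
  shows "\<bar>reward m \<xi> x\<bar> \<le> (\<Sum>j<m. \<bar>fst \<xi> j\<bar>)"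
proof -
  have x: "\<bar>x j\<bar> \<le> 1" for j using Delta_cases[OF assms, of j] by auto
  have "\<bar>reward m \<xi> x\<bar> \<le> (\<Sum>j<m. \<bar>fst \<xi> j * x j\<bar>)"
    unfolding reward_def by (rule sum_abs)
  also have "\<dots> \<le> (\<Sum>j<m. \<bar>fst \<xi> j\<bar> * 1)"
    unfolding abs_mult using x by (intro sum_mono mult_left_mono) auto
  finally show ?thesis by simp
qed

text \<open>
Thin an optimal solution of the \<open>n\<close>-item problem. When the kept items fit into the capacity \<open>c\<close>
and number at most \<open>s\<close>, they are feasible for their own subproblem; otherwise only the trivial bound
\<open>0\<close> is used. The number of items is handled as one more resource, with capacity \<open>n\<close> and unit
consumption, which is why \<open>N \<le> n\<close> is required and \<open>d + 1\<close> constraints appear.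
\<close>

lemma OPT_thin:
  fixes b c :: "real ^ 'd::finite"
  assumes b: "b \<in> capacities" and c: "c \<in> capacities"
    and \<xi>: "\<And>i. i < n \<Longrightarrow> \<xi> i \<in> items m"
    and A: "\<And>i j k. i < n \<Longrightarrow> j < m \<Longrightarrow> N * snd (\<xi> i) j $ k \<le> b $ k"
    and N: "0 < N" "N \<le> real n" and q: "0 \<le> q" "q \<le> 1" and th: "0 < \<theta>"
    and cb: "\<And>k. (q + \<theta>) * b $ k \<le> c $ k" and s: "(q + \<theta>) * real n \<le> real s"
  shows "q * (1 - (real CARD('d) + 1) / (N * \<theta>\<^sup>2)) * OPT m b (map \<xi> [0..<n]) \<le>
    thin q {..<n} (\<lambda>S. if card S \<le> s then OPT m c (map \<xi> (sorted_list_of_set S)) else 0)"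
proof -
  obtain x where x: "\<And>i. x i \<in> Delta m" "\<And>i. 0 \<le> reward m (\<xi> i) (x i)"
    "\<And>k. (\<Sum>i\<in>set [0..<n]. consumption m (\<xi> i) (x i) $ k) \<le> b $ k"
    "OPT m b (map \<xi> [0..<n]) = (\<Sum>i\<in>set [0..<n]. reward m (\<xi> i) (x i))"
    by (rule OPT_attained[where m=m and \<xi>=\<xi> and l="[0..<n]" and c=b])
      (use b \<xi> in auto)
  have set_eq: "set [0..<n] = {..<n}" by auto
  define r where "r i = reward m (\<xi> i) (x i)" for i
  define a where "a k i = consumption m (\<xi> i) (x i) $ k" for k i
  define over where "over f K S = (if sum f S \<le> K then 0 else 1::real)" for f :: "nat \<Rightarrow> real" and K S
  \<comment> \<open>The number of violated constraints: it is at least \<open>1\<close> unless \<open>S\<close> is feasible, so \<open>1 - bad S\<close>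
    bounds the indicator of feasibility from below, linearly in the overflow events.\<close>
  define bad where "bad S = (\<Sum>k\<in>UNIV. over (a k) (c $ k) S) + over (\<lambda>_. 1) (real s) S" for S
  have a0: "0 \<le> a k i" if "i < n" for k i
    unfolding a_def using \<xi> x that by (intro consumption_nonneg)
  have over0: "0 \<le> over f K S" for f K S by (simp add: over_def)
  have value_bound: "(\<Sum>i\<in>S. r i * (1 - bad S)) \<le>
      (if card S \<le> s then OPT m c (map \<xi> (sorted_list_of_set S)) else 0)" if S: "S \<subseteq> {..<n}" for S
  proof (cases "card S \<le> s \<and> (\<forall>k. sum (a k) S \<le> c $ k)")
    case True
    then have "bad S = 0" by (simp add: bad_def over_def)
    moreover have "finite S" using S by (rule finite_subset) simp
    ultimately show ?thesis
      using True x OPT_upper[of "sorted_list_of_set S" x m \<xi> c] by (simp add: r_def a_def)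
  next
    case False
    then have "1 \<le> bad S"
    proof (cases "card S \<le> s")
      case True
      with False obtain k where "\<not> sum (a k) S \<le> c $ k" by auto
      then have "1 = over (a k) (c $ k) S" by (simp add: over_def)
      also have "\<dots> \<le> (\<Sum>k\<in>UNIV. over (a k) (c $ k) S)"
        by (intro member_le_sum over0) auto
      finally show ?thesis using over0[of "\<lambda>_. 1" "real s" S] by (simp add: bad_def)
    next
      case False
      then have "over (\<lambda>_. 1) (real s) S = 1" by (simp add: over_def)
      moreover have "0 \<le> (\<Sum>k\<in>UNIV. over (a k) (c $ k) S)" by (intro sum_nonneg over0)
      ultimately show ?thesis by (simp add: bad_def)
    qed
    then have "(\<Sum>i\<in>S. r i * (1 - bad S)) \<le> 0"
      using x(2) by (intro sum_nonpos mult_nonneg_nonpos) (auto simp: r_def)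
    moreover have "0 \<le> (if card S \<le> s then OPT m c (map \<xi> (sorted_list_of_set S)) else 0)"
      using OPT_nonneg[OF c] by simp
    ultimately show ?thesis by (rule order_trans)
  qed
  have member: "q * (1 - (real CARD('d) + 1) / (N * \<theta>\<^sup>2)) \<le> thin q {..<n} (\<lambda>S. if i \<in> S then 1 - bad S else 0)"
    if i: "i < n" for i
  proof -
    have ov: "thin q {..<n} (\<lambda>S. if i \<in> S then over (a k) (c $ k) S else 0) \<le> q / (N * \<theta>\<^sup>2)" for k
      unfolding over_def
    proof (rule thin_overflow[where C="b $ k"])
      show "N * a k l \<le> b $ k" if "l \<in> {..<n}" for l
        unfolding a_def using A b x that by (intro consumption_le) (auto simp: capacities_def)
    qed (use i q N th a0 x(3) cb in \<open>auto simp: a_def lessThan_atLeast0\<close>)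
    have cnt: "thin q {..<n} (\<lambda>S. if i \<in> S then over (\<lambda>_. 1) (real s) S else 0) \<le> q / (N * \<theta>\<^sup>2)"
      unfolding over_def
      by (rule thin_overflow[where C="real n"]) (use i q N th s in auto)
    have one: "thin q {..<n} (\<lambda>S. if i \<in> S then 1 else 0) = q"
      using i by (simp add: thin_member thin_const)
    have "thin q {..<n} (\<lambda>S. if i \<in> S then 1 - bad S else 0) =
       thin q {..<n} (\<lambda>S. (if i \<in> S then 1 else 0) - ((\<Sum>k\<in>UNIV. if i \<in> S then over (a k) (c $ k) S else 0)
          + (if i \<in> S then over (\<lambda>_. 1) (real s) S else 0)))"
      by (intro thin_cong) (auto simp: bad_def)
    also have "\<dots> = q - ((\<Sum>k\<in>UNIV. thin q {..<n} (\<lambda>S. if i \<in> S then over (a k) (c $ k) S else 0))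
          + thin q {..<n} (\<lambda>S. if i \<in> S then over (\<lambda>_. 1) (real s) S else 0))"
      unfolding thin_diff thin_add thin_sum one ..
    also have "\<dots> \<ge> q - ((\<Sum>k\<in>(UNIV::'d set). q / (N * \<theta>\<^sup>2)) + q / (N * \<theta>\<^sup>2))"
      by (intro diff_left_mono add_mono sum_mono ov cnt)
    finally show ?thesis by (simp add: algebra_simps add_divide_distrib)
  qed
  have "q * (1 - (real CARD('d) + 1) / (N * \<theta>\<^sup>2)) * OPT m b (map \<xi> [0..<n]) =
      (\<Sum>i<n. r i * (q * (1 - (real CARD('d) + 1) / (N * \<theta>\<^sup>2))))"
    unfolding x(4) set_eq r_def by (simp only: sum_distrib_right[symmetric] mult.commute)
  also have "\<dots> \<le> (\<Sum>i<n. r i * thin q {..<n} (\<lambda>S. if i \<in> S then 1 - bad S else 0))"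
    using x(2) by (intro sum_mono mult_left_mono member) (auto simp: r_def)
  also have "\<dots> = thin q {..<n} (\<lambda>S. \<Sum>i<n. r i * (if i \<in> S then 1 - bad S else 0))"
    by (simp add: thin_sum thin_cmult)
  also have "\<dots> = thin q {..<n} (\<lambda>S. \<Sum>i\<in>S. r i * (1 - bad S))"
    by (intro thin_cong sum.mono_neutral_cong_right) auto
  also have "\<dots> \<le> thin q {..<n} (\<lambda>S. if card S \<le> s then OPT m c (map \<xi> (sorted_list_of_set S)) else 0)"
    by (intro thin_mono q value_bound)
  finally show ?thesis .
qed

section \<open>Independence of past and fresh randomness\<close>

text \<open>
The random elements \<open>p\<close> and \<open>f\<close> are independent with laws \<open>N\<close> and \<open>F\<close>. Below \<open>p\<close> is the past
of the algorithm and \<open>f\<close> the randomness that enters in the current period.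
\<close>

definition splits ::
    "'a measure \<Rightarrow> 'b measure \<Rightarrow> 'c measure \<Rightarrow> ('a \<Rightarrow> 'b) \<Rightarrow> ('a \<Rightarrow> 'c) \<Rightarrow> bool" where
  "splits M N F p f \<longleftrightarrow> p \<in> M \<rightarrow>\<^sub>M N \<and> f \<in> M \<rightarrow>\<^sub>M F \<and>
     distr M (N \<Otimes>\<^sub>M F) (\<lambda>\<omega>. (p \<omega>, f \<omega>)) = N \<Otimes>\<^sub>M F"

lemma distr_pair_interchange:
  assumes "prob_space A" "prob_space B" "prob_space C" "prob_space D"
  shows "distr ((A \<Otimes>\<^sub>M B) \<Otimes>\<^sub>M (C \<Otimes>\<^sub>M D)) ((A \<Otimes>\<^sub>M C) \<Otimes>\<^sub>M (B \<Otimes>\<^sub>M D))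
      (\<lambda>z. ((fst (fst z), fst (snd z)), (snd (fst z), snd (snd z)))) = (A \<Otimes>\<^sub>M C) \<Otimes>\<^sub>M (B \<Otimes>\<^sub>M D)"
    (is "distr ?L ?R ?h = _")
proof (rule measure_eqI)
  interpret A: prob_space A by fact
  interpret B: prob_space B by fact
  interpret C: prob_space C by fact
  interpret D: prob_space D by fact
  interpret BC: pair_sigma_finite B C ..
  interpret CD: pair_prob_space C D ..
  interpret BD: pair_prob_space B D ..
  have h[measurable]: "?h \<in> ?L \<rightarrow>\<^sub>M ?R" by measurable
  fix X assume "X \<in> sets (distr ?L ?R ?h)"
  then have X[measurable]: "X \<in> sets ?R" by simp
  let ?i = "\<lambda>a b c d. indicator X ((a, c), (b, d)) :: ennreal"
  have "emeasure (distr ?L ?R ?h) X = (\<integral>\<^sup>+ z. indicator X (?h z) \<partial>?L)"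
    by (subst nn_integral_indicator[symmetric], simp, subst nn_integral_distr) auto
  also have "\<dots> = (\<integral>\<^sup>+ x. \<integral>\<^sup>+ y. indicator X (?h (x, y)) \<partial>(C \<Otimes>\<^sub>M D) \<partial>(A \<Otimes>\<^sub>M B))"
    by (subst CD.nn_integral_fst[symmetric]) auto
  also have "\<dots> = (\<integral>\<^sup>+ a. \<integral>\<^sup>+ b. \<integral>\<^sup>+ y. indicator X (?h ((a, b), y)) \<partial>(C \<Otimes>\<^sub>M D) \<partial>B \<partial>A)"
    by (subst B.nn_integral_fst[symmetric]) auto
  also have "\<dots> = (\<integral>\<^sup>+ a. \<integral>\<^sup>+ b. \<integral>\<^sup>+ c. \<integral>\<^sup>+ d. ?i a b c d \<partial>D \<partial>C \<partial>B \<partial>A)"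
    by (intro nn_integral_cong, subst D.nn_integral_fst[symmetric]) auto
  also have "\<dots> = (\<integral>\<^sup>+ a. \<integral>\<^sup>+ c. \<integral>\<^sup>+ b. \<integral>\<^sup>+ d. ?i a b c d \<partial>D \<partial>B \<partial>C \<partial>A)"
    by (intro nn_integral_cong BC.Fubini'[symmetric]) simp
  also have "\<dots> = (\<integral>\<^sup>+ a. \<integral>\<^sup>+ c. \<integral>\<^sup>+ y. indicator X ((a, c), y) \<partial>(B \<Otimes>\<^sub>M D) \<partial>C \<partial>A)"
    by (intro nn_integral_cong, subst D.nn_integral_fst[symmetric]) auto
  also have "\<dots> = (\<integral>\<^sup>+ x. \<integral>\<^sup>+ y. indicator X (x, y) \<partial>(B \<Otimes>\<^sub>M D) \<partial>(A \<Otimes>\<^sub>M C))"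
    by (subst C.nn_integral_fst[symmetric]) auto
  also have "\<dots> = (\<integral>\<^sup>+ z. indicator X z \<partial>?R)"
    by (subst BD.nn_integral_fst[symmetric]) auto
  finally show "emeasure (distr ?L ?R ?h) X = emeasure ?R X" by simp
qed simp

lemma distr_pair_assoc:
  assumes "prob_space A" "prob_space B" "prob_space C"
  shows "distr (A \<Otimes>\<^sub>M B \<Otimes>\<^sub>M C) ((A \<Otimes>\<^sub>M B) \<Otimes>\<^sub>M C) (\<lambda>z. ((fst z, fst (snd z)), snd (snd z))) =
    (A \<Otimes>\<^sub>M B) \<Otimes>\<^sub>M C" (is "distr ?L ?R ?h = _")
proof (rule measure_eqI)
  interpret A: prob_space A by fact
  interpret B: prob_space B by fact
  interpret C: prob_space C by fact
  interpret BC: pair_prob_space B C ..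
  have h[measurable]: "?h \<in> ?L \<rightarrow>\<^sub>M ?R" by measurable
  fix X assume "X \<in> sets (distr ?L ?R ?h)"
  then have X[measurable]: "X \<in> sets ?R" by simp
  have "emeasure (distr ?L ?R ?h) X = (\<integral>\<^sup>+ z. indicator X (?h z) \<partial>?L)"
    by (subst nn_integral_indicator[symmetric], simp, subst nn_integral_distr) auto
  also have "\<dots> = (\<integral>\<^sup>+ a. \<integral>\<^sup>+ y. indicator X (?h (a, y)) \<partial>(B \<Otimes>\<^sub>M C) \<partial>A)"
    by (subst BC.nn_integral_fst[symmetric]) auto
  also have "\<dots> = (\<integral>\<^sup>+ a. \<integral>\<^sup>+ b. \<integral>\<^sup>+ c. indicator X ((a, b), c) \<partial>C \<partial>B \<partial>A)"
    by (intro nn_integral_cong, subst C.nn_integral_fst[symmetric]) auto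
  also have "\<dots> = (\<integral>\<^sup>+ x. \<integral>\<^sup>+ c. indicator X (x, c) \<partial>C \<partial>(A \<Otimes>\<^sub>M B))"
    by (subst B.nn_integral_fst[symmetric]) auto
  also have "\<dots> = (\<integral>\<^sup>+ z. indicator X z \<partial>?R)"
    by (subst C.nn_integral_fst[symmetric]) auto
  finally show "emeasure (distr ?L ?R ?h) X = emeasure ?R X" by simp
qed simp

lemma splits_pair:
  assumes "prob_space N1" "prob_space F1" "prob_space N2" "prob_space F2"
    and s1: "splits M1 N1 F1 p1 f1" and s2: "splits M2 N2 F2 p2 f2"
  shows "splits (M1 \<Otimes>\<^sub>M M2) (N1 \<Otimes>\<^sub>M N2) (F1 \<Otimes>\<^sub>M F2)
    (\<lambda>(x, y). (p1 x, p2 y)) (\<lambda>(x, y). (f1 x, f2 y))"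
proof -
  have [measurable]: "p1 \<in> M1 \<rightarrow>\<^sub>M N1" "f1 \<in> M1 \<rightarrow>\<^sub>M F1" "p2 \<in> M2 \<rightarrow>\<^sub>M N2" "f2 \<in> M2 \<rightarrow>\<^sub>M F2"
    using s1 s2 by (auto simp: splits_def)
  have d1: "distr M1 (N1 \<Otimes>\<^sub>M F1) (\<lambda>x. (p1 x, f1 x)) = N1 \<Otimes>\<^sub>M F1"
    and d2: "distr M2 (N2 \<Otimes>\<^sub>M F2) (\<lambda>x. (p2 x, f2 x)) = N2 \<Otimes>\<^sub>M F2"
    using s1 s2 by (auto simp: splits_def)
  have sf: "sigma_finite_measure (N2 \<Otimes>\<^sub>M F2)"
    using assms by (intro prob_space_imp_sigma_finite prob_space_pair)
  have "(N1 \<Otimes>\<^sub>M N2) \<Otimes>\<^sub>M (F1 \<Otimes>\<^sub>M F2) = distr ((N1 \<Otimes>\<^sub>M F1) \<Otimes>\<^sub>M (N2 \<Otimes>\<^sub>M F2))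
      ((N1 \<Otimes>\<^sub>M N2) \<Otimes>\<^sub>M (F1 \<Otimes>\<^sub>M F2)) (\<lambda>z. ((fst (fst z), fst (snd z)), (snd (fst z), snd (snd z))))"
    by (rule distr_pair_interchange[symmetric]) fact+
  also have "(N1 \<Otimes>\<^sub>M F1) \<Otimes>\<^sub>M (N2 \<Otimes>\<^sub>M F2) = distr (M1 \<Otimes>\<^sub>M M2) ((N1 \<Otimes>\<^sub>M F1) \<Otimes>\<^sub>M (N2 \<Otimes>\<^sub>M F2))
      (\<lambda>(x, y). ((p1 x, f1 x), (p2 y, f2 y)))"
    using pair_measure_distr[of "\<lambda>x. (p1 x, f1 x)" M1 "N1 \<Otimes>\<^sub>M F1" "\<lambda>x. (p2 x, f2 x)" M2 "N2 \<Otimes>\<^sub>M F2"]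
    by (simp add: d1 d2 sf)
  finally show ?thesis
    unfolding splits_def by (simp add: distr_distr comp_def split_beta')
qed

lemma splits_map:
  assumes s: "splits M N F p f" and h: "h \<in> F \<rightarrow>\<^sub>M G" "distr F G h = G"
    and "prob_space N" "prob_space F" "prob_space G"
  shows "splits M N G p (\<lambda>\<omega>. h (f \<omega>))"
proof -
  have [measurable]: "p \<in> M \<rightarrow>\<^sub>M N" "f \<in> M \<rightarrow>\<^sub>M F" "h \<in> F \<rightarrow>\<^sub>M G"
    using s h by (auto simp: splits_def)
  have sf: "sigma_finite_measure G" using assms by (intro prob_space_imp_sigma_finite)
  have "N \<Otimes>\<^sub>M G = distr N N (\<lambda>x. x) \<Otimes>\<^sub>M distr F G h" by (simp add: h)
  also have "\<dots> = distr (N \<Otimes>\<^sub>M F) (N \<Otimes>\<^sub>M G) (\<lambda>(x, y). (x, h y))"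
    by (rule pair_measure_distr) (auto simp: h sf)
  also have "N \<Otimes>\<^sub>M F = distr M (N \<Otimes>\<^sub>M F) (\<lambda>\<omega>. (p \<omega>, f \<omega>))"
    using s by (simp add: splits_def)
  finally show ?thesis
    unfolding splits_def by (simp add: distr_distr comp_def split_beta')
qed

lemma splits_PiM:
  fixes P R I :: "'i set" and D :: "'a measure"
  assumes D: "prob_space D" and PR: "finite P" "finite R" "P \<inter> R = {}" "P \<subseteq> I" "R \<subseteq> I"
  shows "splits (\<Pi>\<^sub>M i\<in>I. D) (\<Pi>\<^sub>M i\<in>P. D) (\<Pi>\<^sub>M i\<in>R. D) (\<lambda>x. restrict x P) (\<lambda>x. restrict x R)"
proof -
  interpret D: prob_space D by fact
  interpret product_sigma_finite "\<lambda>_. D" ..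
  let ?P = "\<lambda>I. \<Pi>\<^sub>M i\<in>I. D"
  have r[measurable]: "(\<lambda>x. restrict x J) \<in> ?P I \<rightarrow>\<^sub>M ?P J" if "J \<subseteq> I" for I J :: "'i set"
    using that by (rule measurable_restrict_subset)
  have "distr (?P P \<Otimes>\<^sub>M ?P R) (?P P \<Otimes>\<^sub>M ?P R) (\<lambda>x. x) =
      distr (?P P \<Otimes>\<^sub>M ?P R) (?P P \<Otimes>\<^sub>M ?P R) (\<lambda>z. (restrict (merge P R z) P, restrict (merge P R z) R))"
  proof (intro distr_cong refl)
    fix z assume "z \<in> space (?P P \<Otimes>\<^sub>M ?P R)"
    then have "fst z \<in> extensional P" "snd z \<in> extensional R"
      by (auto simp: space_pair_measure space_PiM PiE_def)
    then show "z = (restrict (merge P R z) P, restrict (merge P R z) R)"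
      using PR(3) by (cases z) (auto simp: extensional_restrict)
  qed
  also have "\<dots> = distr (distr (?P P \<Otimes>\<^sub>M ?P R) (?P (P \<union> R)) (merge P R)) (?P P \<Otimes>\<^sub>M ?P R)
      (\<lambda>x. (restrict x P, restrict x R))"
    by (subst distr_distr) (auto simp: comp_def intro!: measurable_Pair r)
  also have "distr (?P P \<Otimes>\<^sub>M ?P R) (?P (P \<union> R)) (merge P R) = ?P (P \<union> R)"
    using PR by (intro distr_merge)
  also have "?P (P \<union> R) = distr (?P I) (?P (P \<union> R)) (\<lambda>x. restrict x (P \<union> R))"
    by (rule distr_PiM_reindex[of I "\<lambda>_. D" "\<lambda>i. i" "P \<union> R", symmetric]) (use D PR in auto)
  finally have "?P P \<Otimes>\<^sub>M ?P R = distr (?P I) (?P P \<Otimes>\<^sub>M ?P R) (\<lambda>x. (restrict x P, restrict x R))"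
    using PR by (subst (asm) distr_distr)
      (auto simp: comp_def Int_absorb1 restrict_restrict distr_id intro!: measurable_Pair r)
  then show ?thesis
    unfolding splits_def using PR by (auto intro!: r)
qed

text \<open>
Fubini's theorem under a split: the fresh part can be integrated out with the past held fixed. The
dominating function depends on the fresh part alone, as rewards are integrable but unbounded.
\<close>

lemma splits_integral:
  fixes g :: "'b \<Rightarrow> 'c \<Rightarrow> real"
  assumes s: "splits M N F p f" and N: "prob_space N" and F: "prob_space F"
    and g: "(\<lambda>(x, y). g x y) \<in> borel_measurable (N \<Otimes>\<^sub>M F)"
    and G: "integrable F G" "\<And>x y. x \<in> space N \<Longrightarrow> y \<in> space F \<Longrightarrow> \<bar>g x y\<bar> \<le> G y"
  shows "integrable M (\<lambda>\<omega>. g (p \<omega>) (f \<omega>))"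
    and "integrable M (\<lambda>\<omega>. \<integral>y. g (p \<omega>) y \<partial>F)"
    and "(\<integral>\<omega>. g (p \<omega>) (f \<omega>) \<partial>M) = (\<integral>\<omega>. (\<integral>y. g (p \<omega>) y \<partial>F) \<partial>M)"
proof -
  interpret N: prob_space N by fact
  interpret F: prob_space F by fact
  interpret NF: pair_sigma_finite N F ..
  interpret FN: pair_sigma_finite F N ..
  have p[measurable]: "p \<in> M \<rightarrow>\<^sub>M N" and f[measurable]: "f \<in> M \<rightarrow>\<^sub>M F"
    and d: "distr M (N \<Otimes>\<^sub>M F) (\<lambda>\<omega>. (p \<omega>, f \<omega>)) = N \<Otimes>\<^sub>M F"
    using s by (auto simp: splits_def)
  have dp: "distr M M' p = N" if "M' = N" for M'
  proof -
    have "N = distr (N \<Otimes>\<^sub>M F) N fst" by (rule F.distr_pair_fst[symmetric])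
    also have "\<dots> = distr (distr M (N \<Otimes>\<^sub>M F) (\<lambda>\<omega>. (p \<omega>, f \<omega>))) N fst" by (simp only: d)
    also have "\<dots> = distr M N p" by (subst distr_distr) (auto simp: comp_def)
    finally show ?thesis using that by simp
  qed
  have "integrable (distr (F \<Otimes>\<^sub>M N) F fst) G"
    using G(1) by (simp only: N.distr_pair_fst)
  then have "integrable (F \<Otimes>\<^sub>M N) (\<lambda>z. G (fst z))"
    using G(1) by (subst (asm) integrable_distr_eq) auto
  from FN.integrable_product_swap[OF this]
  have "integrable (N \<Otimes>\<^sub>M F) (\<lambda>z. G (snd z))" by (simp add: split_beta')
  then have int: "integrable (N \<Otimes>\<^sub>M F) (\<lambda>(x, y). g x y)"
    by (rule Bochner_Integration.integrable_bound[OF _ g])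
      (auto simp: space_pair_measure intro!: AE_I2 order_trans[OF G(2)])
  have meas[measurable]: "(\<lambda>x. \<integral>y. g x y \<partial>F) \<in> borel_measurable N"
    using g by (intro F.borel_measurable_lebesgue_integral)
  have "integrable (distr M (N \<Otimes>\<^sub>M F) (\<lambda>\<omega>. (p \<omega>, f \<omega>))) (\<lambda>(x, y). g x y)"
    using int by (simp only: d)
  then show "integrable M (\<lambda>\<omega>. g (p \<omega>) (f \<omega>))"
    using g by (subst (asm) integrable_distr_eq) auto
  have "integrable N (\<lambda>x. \<integral>y. g x y \<partial>F)" by (rule NF.integrable_fst[OF int])
  then have "integrable (distr M N p) (\<lambda>x. \<integral>y. g x y \<partial>F)" by (simp only: dp[OF refl])
  then show "integrable M (\<lambda>\<omega>. \<integral>y. g (p \<omega>) y \<partial>F)"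
    using meas by (subst (asm) integrable_distr_eq) auto
  have "(\<integral>\<omega>. g (p \<omega>) (f \<omega>) \<partial>M) = (\<integral>z. (\<lambda>(x, y). g x y) z \<partial>(distr M (N \<Otimes>\<^sub>M F) (\<lambda>\<omega>. (p \<omega>, f \<omega>))))"
    using g by (subst integral_distr) auto
  also have "\<dots> = (\<integral>x. (\<integral>y. g x y \<partial>F) \<partial>(distr M N p))"
    unfolding d dp[OF refl] by (rule NF.integral_fst[OF int, symmetric])
  also have "\<dots> = (\<integral>\<omega>. (\<integral>y. g (p \<omega>) y \<partial>F) \<partial>M)"
    by (subst integral_distr) auto
  finally show "(\<integral>\<omega>. g (p \<omega>) (f \<omega>) \<partial>M) = (\<integral>\<omega>. (\<integral>y. g (p \<omega>) y \<partial>F) \<partial>M)" .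
qed

section \<open>The value of the offline problem\<close>

lemma fst_item_measurable: "(\<lambda>\<xi>. fst \<xi> j) \<in> borel_measurable (item_space m)"
proof -
  have "continuous_on UNIV (\<lambda>\<xi> :: 'd::finite item. fst \<xi> j)"
    by (rule continuous_on_product_then_coordinatewise) (rule continuous_on_fst[OF continuous_on_id])
  then show ?thesis
    unfolding item_space_def by (intro measurable_restrict_space1 borel_measurable_continuous_onI)
qed

lemma snd_item_measurable: "(\<lambda>\<xi>. snd \<xi> j $ k) \<in> borel_measurable (item_space m)"
proof -
  have "continuous_on UNIV (\<lambda>\<xi> :: 'd::finite item. snd \<xi> j)"
    by (rule continuous_on_product_then_coordinatewise) (rule continuous_on_snd[OF continuous_on_id])
  then show ?thesis
    unfolding item_space_def
    by (intro measurable_restrict_space1 borel_measurable_continuous_onI continuous_on_component)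
qed

lemma decision_component_measurable: "(\<lambda>z. snd z j) \<in> borel_measurable (M \<Otimes>\<^sub>M count_space UNIV)"
  by (rule measurable_compose[OF measurable_snd]) simp

lemma reward_measurable:
  "(\<lambda>z. reward m (fst z) (snd z)) \<in> borel_measurable (item_space m \<Otimes>\<^sub>M count_space UNIV)"
  unfolding reward_def
  by (intro borel_measurable_sum borel_measurable_times decision_component_measurable
      measurable_compose[OF measurable_fst fst_item_measurable])

lemma consumption_measurable:
  "(\<lambda>z. consumption m (fst z) (snd z) $ k) \<in> borel_measurable (item_space m \<Otimes>\<^sub>M count_space UNIV)"
  unfolding consumption_def vec_lambda_beta
  by (intro borel_measurable_sum borel_measurable_times decision_component_measurable
      measurable_compose[OF measurable_fst snd_item_measurable])

text \<open>
One horizon. The number \<open>N\<close> is a lower bound on the capacity scale: every item consumes at most the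
fraction \<open>1 / N\<close> of each capacity.
\<close>

locale online_allocation =
  fixes m :: nat
    and b :: "real ^ 'd::finite"
    and D :: "'d item measure"
    and U :: "'u measure"
    and sol :: "('d, 'u) solver"
    and N :: real
  assumes b: "b \<in> capacities"
    and prob_D: "prob_space D"
    and sets_D: "sets D = sets (item_space m)"
    and integrable_fst: "\<And>j. j < m \<Longrightarrow> integrable D (\<lambda>\<xi>. fst \<xi> j)"
    and exact: "exact_solver U sol"
    and equivariant: "equivariant U sol"
    and N_pos: "0 < N"
    and small: "AE \<xi> in D. \<forall>j<m. \<forall>k. N * snd \<xi> j $ k \<le> b $ k"
begin

abbreviation samples :: "'i set \<Rightarrow> ('i \<Rightarrow> 'd item) measure" where
  "samples I \<equiv> \<Pi>\<^sub>M i\<in>I. D"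

definition V :: "nat \<Rightarrow> real ^ 'd \<Rightarrow> real" where
  "V n c = (\<integral>y. OPT m c (map y [0..<n]) \<partial>samples {..<n})"

lemma prob_U: "prob_space U"
  using exact by (simp add: exact_solver_def)

lemma prob_samples: "prob_space (samples I)"
  by (intro prob_space_PiM prob_D)

lemma space_D: "space D = items m"
  using sets_eq_imp_space_eq[OF sets_D] by (simp add: item_space_def space_restrict_space)

lemma samples_items: "y \<in> space (samples I) \<Longrightarrow> i \<in> I \<Longrightarrow> y i \<in> items m"
  by (auto simp: space_PiM space_D PiE_def Pi_def)

lemma component_measurable:
  assumes "f \<in> borel_measurable (item_space m)" "i \<in> I"
  shows "(\<lambda>y. f (y i)) \<in> borel_measurable (samples I)"
proof -
  have "f \<in> borel_measurable D" using assms(1) by (simp only: measurable_cong_sets[OF sets_D refl])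
  then show ?thesis using assms(2) by measurable
qed

lemma integrable_component:
  assumes "integrable D f" "i \<in> I"
  shows "integrable (samples I) (\<lambda>y. f (y i) :: real)"
proof -
  have "integrable (distr (samples I) D (\<lambda>y. y i)) f"
    using assms by (subst distr_PiM_component) (auto intro: prob_D)
  then show ?thesis
    using assms by (subst (asm) integrable_distr_eq) auto
qed

definition reward_size :: "'d item \<Rightarrow> real" where
  "reward_size \<xi> = (\<Sum>j<m. \<bar>fst \<xi> j\<bar>)"

lemma integrable_reward_size: "integrable D reward_size"
  unfolding reward_size_def using integrable_fst
  by (intro Bochner_Integration.integrable_sum Bochner_Integration.integrable_abs) auto

lemma reward_le_size: "x \<in> Delta m \<Longrightarrow> \<bar>reward m \<xi> x\<bar> \<le> reward_size \<xi>"
  unfolding reward_size_def by (rule reward_bound)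

text \<open>
A maximum over a set of candidate solutions that is independent of the items, which makes the
optimum measurable. Infeasible candidates get the value \<open>0\<close>, harmless because the optimum is
nonnegative.
\<close>

lemma OPT_eq_Max:
  assumes c: "c \<in> capacities"
  shows "OPT m c (map y l) = Max ((\<lambda>xs.
      if \<forall>k. (\<Sum>i<length l. consumption m (y (l ! i)) (xs ! i) $ k) \<le> c $ k
      then (\<Sum>i<length l. reward m (y (l ! i)) (xs ! i)) else 0) `
    {xs. set xs \<subseteq> Delta m \<and> length xs = length l})" (is "_ = Max (?f ` ?X)")
proof (rule Max_eqI[symmetric])
  show "finite (?f ` ?X)"
    by (intro finite_imageI finite_lists_length_eq finite_Delta)
  have f: "?f xs = (if xs \<in> feasible m c (map y l) then total_reward m (map y l) xs else 0)"
    if "xs \<in> ?X" for xs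
    using that by (auto simp: feasible_def total_reward_def)
  show "z \<le> OPT m c (map y l)" if "z \<in> ?f ` ?X" for z
  proof -
    from that obtain xs where "xs \<in> ?X" "z = ?f xs" by blast
    then show ?thesis
      using f[of xs] OPT_nonneg[OF c, of m "map y l"]
      by (auto simp: OPT_def intro!: Max_ge finite_imageI finite_feasible)
  qed
  have "OPT m c (map y l) \<in> total_reward m (map y l) ` feasible m c (map y l)"
    unfolding OPT_def using replicate_feasible[OF c, of "map y l" m]
    by (intro Max_in finite_imageI finite_feasible) auto
  then obtain xs where xs: "xs \<in> feasible m c (map y l)" "OPT m c (map y l) = total_reward m (map y l) xs"
    by auto
  from xs(1) have X: "xs \<in> ?X" by (simp add: feasible_def)
  have "OPT m c (map y l) = ?f xs" unfolding f[OF X] using xs by (simp only: if_True)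
  then show "OPT m c (map y l) \<in> ?f ` ?X" using X by (rule image_eqI)
qed

lemma OPT_measurable:
  assumes c: "c \<in> capacities" and l: "set l \<subseteq> I"
  shows "(\<lambda>y. OPT m c (map y l)) \<in> borel_measurable (samples I)"
proof -
  have r: "(\<lambda>y. reward m (y (l ! i)) x) \<in> borel_measurable (samples I)" if "i < length l" for i x
    using l that unfolding reward_def
    by (intro component_measurable[of "\<lambda>\<xi>. \<Sum>j<m. fst \<xi> j * x j"] borel_measurable_sum
        borel_measurable_times fst_item_measurable) auto
  have k: "(\<lambda>y. consumption m (y (l ! i)) x $ k) \<in> borel_measurable (samples I)" if "i < length l" for i x k
    using l that unfolding consumption_def vec_lambda_beta
    by (intro component_measurable[of "\<lambda>\<xi>. \<Sum>j<m. snd \<xi> j $ k * x j"] borel_measurable_sum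
        borel_measurable_times snd_item_measurable) auto
  have f: "(\<lambda>y. if \<forall>k. (\<Sum>i<length l. consumption m (y (l ! i)) (xs ! i) $ k) \<le> c $ k
      then (\<Sum>i<length l. reward m (y (l ! i)) (xs ! i)) else 0) \<in> borel_measurable (samples I)"
    for xs :: "decision list"
  proof (rule measurable_If)
    have 1: "(\<lambda>y. \<Sum>i<length l. consumption m (y (l ! i)) (xs ! i) $ k) \<in> borel_measurable (samples I)" for k
      by (intro borel_measurable_sum k) auto
    have "{y \<in> space (samples I). \<forall>k\<in>UNIV. (\<Sum>i<length l. consumption m (y (l ! i)) (xs ! i) $ k) \<le> c $ k}
        \<in> sets (samples I)"
      by (rule sets.sets_Collect_finite_All) (auto intro: borel_measurable_le 1)
    then show "{y \<in> space (samples I). \<forall>k. (\<Sum>i<length l. consumption m (y (l ! i)) (xs ! i) $ k) \<le> c $ k}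
        \<in> sets (samples I)" by simp
    show "(\<lambda>y. \<Sum>i<length l. reward m (y (l ! i)) (xs ! i)) \<in> borel_measurable (samples I)"
      by (intro borel_measurable_sum r) auto
  qed (rule borel_measurable_const)
  show ?thesis
    unfolding OPT_eq_Max[OF c]
    by (rule borel_measurable_Max[OF finite_lists_length_eq[OF finite_Delta] f])
qed

lemma OPT_le_size:
  assumes "c \<in> capacities" "distinct l" "\<And>i. i \<in> set l \<Longrightarrow> y i \<in> items m"
  shows "OPT m c (map y l) \<le> (\<Sum>i\<in>set l. reward_size (y i))"
proof -
  obtain x where x: "\<And>i. x i \<in> Delta m" "OPT m c (map y l) = (\<Sum>i\<in>set l. reward m (y i) (x i))"
    by (rule OPT_attained[where m=m and \<xi>=y and l=l and c=c]) (use assms in auto)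
  show ?thesis
    unfolding x(2) by (intro sum_mono) (rule abs_le_D1[OF reward_le_size[OF x(1)]])
qed

lemma OPT_integrable:
  assumes "c \<in> capacities" "distinct l" "set l \<subseteq> I"
  shows "integrable (samples I) (\<lambda>y. OPT m c (map y l))"
proof (rule Bochner_Integration.integrable_bound)
  show "integrable (samples I) (\<lambda>y. \<Sum>i\<in>set l. reward_size (y i))"
    using assms by (intro Bochner_Integration.integrable_sum integrable_component integrable_reward_size) auto
  show "AE y in samples I. norm (OPT m c (map y l)) \<le> norm (\<Sum>i\<in>set l. reward_size (y i))"
  proof (rule AE_I2)
    fix y assume "y \<in> space (samples I)"
    from samples_items[OF this] have "OPT m c (map y l) \<le> (\<Sum>i\<in>set l. reward_size (y i))"
      using assms by (intro OPT_le_size) auto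
    with OPT_nonneg[OF assms(1), of m "map y l"]
    show "norm (OPT m c (map y l)) \<le> norm (\<Sum>i\<in>set l. reward_size (y i))" by simp
  qed
qed (rule OPT_measurable[OF assms(1,3)])

text \<open>
By identical distribution, only the number of items in a subproblem matters.
\<close>

lemma integral_OPT_sublist:
  assumes c: "c \<in> capacities" and l: "distinct l" "set l \<subseteq> I"
  shows "(\<integral>y. OPT m c (map y l) \<partial>samples I) = V (length l) c"
proof -
  let ?h = "\<lambda>y. \<lambda>i\<in>{..<length l}. y (l ! i)"
  have inj: "inj_on ((!) l) {..<length l}" by (rule inj_on_nth[OF l(1)]) simp
  have mem: "l ! i \<in> I" if "i < length l" for i using l(2) nth_mem[OF that] by (rule subsetD)
  have d: "distr (samples I) (samples {..<length l}) ?h = samples {..<length l}"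
    by (rule distr_PiM_reindex[of I "\<lambda>_. D" "(!) l" "{..<length l}", OF prob_D inj]) (simp add: Pi_iff mem)
  have h: "?h \<in> samples I \<rightarrow>\<^sub>M samples {..<length l}"
    by (intro measurable_restrict measurable_component_singleton mem) auto
  have "V (length l) c = (\<integral>y. OPT m c (map y [0..<length l]) \<partial>distr (samples I) (samples {..<length l}) ?h)"
    by (simp add: V_def d)
  also have "\<dots> = (\<integral>y. OPT m c (map (?h y) [0..<length l]) \<partial>samples I)"
    using OPT_measurable[OF c, of "[0..<length l]" "{..<length l}"] h
    by (subst integral_distr) (auto simp: subset_eq)
  also have "\<dots> = (\<integral>y. OPT m c (map y l) \<partial>samples I)"
  proof (intro Bochner_Integration.integral_cong refl)
    show "OPT m c (map (?h y) [0..<length l]) = OPT m c (map y l)" for y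
      by (intro arg_cong[where f="OPT m c"] nth_equalityI) auto
  qed
  finally show ?thesis by simp
qed

lemma V_nonneg: "c \<in> capacities \<Longrightarrow> 0 \<le> V n c"
  unfolding V_def by (intro Bochner_Integration.integral_nonneg OPT_nonneg)

lemma V_mono:
  assumes "c \<in> capacities" "n \<le> s"
  shows "V n c \<le> V s c"
proof -
  have "V n c = (\<integral>y. OPT m c (map y [0..<n]) \<partial>samples {..<s})"
    using integral_OPT_sublist[OF assms(1), of "[0..<n]" "{..<s}"] assms(2) by (auto simp: subset_eq)
  also have "\<dots> \<le> V s c"
    unfolding V_def
  proof (rule Bochner_Integration.integral_mono)
    fix y assume "y \<in> space (samples {..<s})"
    from samples_items[OF this] show "OPT m c (map y [0..<n]) \<le> OPT m c (map y [0..<s])"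
      using assms by (intro OPT_mono_items) auto
  qed (use assms in \<open>auto intro!: OPT_integrable\<close>)
  finally show ?thesis .
qed

text \<open>
Integrating \<open>OPT_thin\<close>: a random subproblem with at most \<open>s\<close> items has expected value at most
\<open>V s c\<close>.
\<close>

lemma V_thin:
  assumes c: "c \<in> capacities" and N: "N \<le> real n"
    and q: "0 \<le> q" "q \<le> 1" and th: "0 < \<theta>"
    and cb: "\<And>k. (q + \<theta>) * b $ k \<le> c $ k" and s: "(q + \<theta>) * real n \<le> real s"
  shows "q * (1 - (real CARD('d) + 1) / (N * \<theta>\<^sup>2)) * V n b \<le> V s c"
proof -
  let ?g = "\<lambda>y S. if card S \<le> s then OPT m c (map y (sorted_list_of_set S)) else 0"
  have fin: "finite S" if "S \<subseteq> {..<n}" for S using that by (rule finite_subset) simp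
  have int: "integrable (samples {..<n}) (\<lambda>y. ?g y S)" if "S \<subseteq> {..<n}" for S
    using OPT_integrable[OF c, of "sorted_list_of_set S" "{..<n}"] fin[OF that] that
    by (cases "card S \<le> s") auto
  have "q * (1 - (real CARD('d) + 1) / (N * \<theta>\<^sup>2)) * V n b =
      (\<integral>y. q * (1 - (real CARD('d) + 1) / (N * \<theta>\<^sup>2)) * OPT m b (map y [0..<n]) \<partial>samples {..<n})"
    by (simp add: V_def)
  also have "\<dots> \<le> (\<integral>y. thin q {..<n} (?g y) \<partial>samples {..<n})"
  proof (rule integral_mono_AE)
    show "integrable (samples {..<n}) (\<lambda>y. q * (1 - (real CARD('d) + 1) / (N * \<theta>\<^sup>2)) * OPT m b (map y [0..<n]))"
      by (intro integrable_mult_right OPT_integrable b) auto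
    show "integrable (samples {..<n}) (\<lambda>y. thin q {..<n} (?g y))"
      unfolding thin_def by (intro Bochner_Integration.integrable_sum integrable_mult_right int) auto
    have "AE y in samples {..<n}. \<forall>i\<in>{..<n}. \<forall>j<m. \<forall>k. N * snd (y i) j $ k \<le> b $ k"
      by (intro AE_finite_allI AE_PiM_component[where P="\<lambda>\<xi>. \<forall>j<m. \<forall>k. N * snd \<xi> j $ k \<le> b $ k"]
          prob_D small) auto
    then show "AE y in samples {..<n}. q * (1 - (real CARD('d) + 1) / (N * \<theta>\<^sup>2)) * OPT m b (map y [0..<n])
        \<le> thin q {..<n} (?g y)"
      using AE_space
    proof eventually_elim
      case (elim y)
      show ?case
        by (rule OPT_thin) (use elim b c N N_pos q th cb s samples_items[OF elim(2)] in auto)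
    qed
  qed
  also have "\<dots> = thin q {..<n} (\<lambda>S. \<integral>y. ?g y S \<partial>samples {..<n})"
    unfolding thin_def using int by (subst Bochner_Integration.integral_sum) auto
  also have "\<dots> \<le> thin q {..<n} (\<lambda>S. V s c)"
  proof (intro thin_mono q)
    fix S assume S: "S \<subseteq> {..<n}"
    show "(\<integral>y. ?g y S \<partial>samples {..<n}) \<le> V s c"
      using integral_OPT_sublist[OF c, of "sorted_list_of_set S" "{..<n}"] fin[OF S] S
        V_mono[OF c, of "card S" s] V_nonneg[OF c, of s] by (cases "card S \<le> s") auto
  qed
  also have "\<dots> = V s c" by (simp add: thin_const)
  finally show ?thesis .
qed

section \<open>One period\<close>

abbreviation fresh_law :: "nat \<Rightarrow> ((nat \<Rightarrow> 'd item) \<times> 'u) measure" where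
  "fresh_law s \<equiv> samples {..<s} \<Otimes>\<^sub>M U"

definition solution :: "nat \<Rightarrow> real ^ 'd \<Rightarrow> (nat \<Rightarrow> 'd item) \<times> 'u \<Rightarrow> decision list" where
  "solution s c z = sol m c (map (fst z) [0..<s]) (snd z)"

lemma prob_fresh: "prob_space (fresh_law s)"
  by (intro prob_space_pair prob_samples prob_U)

lemma solution_measurable:
  "(\<lambda>(c, z). solution s c z) \<in> restrict_space borel capacities \<Otimes>\<^sub>M fresh_law s \<rightarrow>\<^sub>M count_space UNIV"
proof -
  have 1: "(\<lambda>(c, \<xi>, u). sol m c (map \<xi> [0..<s]) u) \<in>
        restrict_space borel capacities \<Otimes>\<^sub>M (\<Pi>\<^sub>M i\<in>{..<s}. item_space m) \<Otimes>\<^sub>M U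
          \<rightarrow>\<^sub>M count_space UNIV"
    using exact by (simp add: exact_solver_def)
  have 2: "sets (restrict_space borel capacities \<Otimes>\<^sub>M (\<Pi>\<^sub>M i\<in>{..<s}. item_space m) \<Otimes>\<^sub>M U) =
      sets (restrict_space borel capacities \<Otimes>\<^sub>M fresh_law s)"
    by (intro sets_pair_measure_cong sets_PiM_cong refl) (simp add: sets_D)
  show ?thesis
    using 1 unfolding measurable_cong_sets[OF 2 refl] solution_def by (simp add: split_beta')
qed

lemma solution_measurable_fixed:
  assumes "c \<in> capacities"
  shows "solution s c \<in> fresh_law s \<rightarrow>\<^sub>M count_space UNIV"
proof -
  have "(\<lambda>z. (c, z)) \<in> fresh_law s \<rightarrow>\<^sub>M restrict_space borel capacities \<Otimes>\<^sub>M fresh_law s"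
    using assms by (intro measurable_Pair measurable_const) (auto simp: space_restrict_space)
  from measurable_compose[OF this solution_measurable] show ?thesis by simp
qed

lemma solution_optimal:
  assumes "c \<in> capacities" "z \<in> space (fresh_law s)"
  shows "solution s c z \<in> optimal m c (map (fst z) [0..<s])"
proof -
  have "set (map (fst z) [0..<s]) \<subseteq> items m" "snd z \<in> space U"
    using assms(2) samples_items[of "fst z" "{..<s}"] by (auto simp: space_pair_measure)
  moreover have "\<forall>m. \<forall>c\<in>capacities. \<forall>\<xi>s. set \<xi>s \<subseteq> items m \<longrightarrow>
      (\<forall>u\<in>space U. sol m c \<xi>s u \<in> optimal m c \<xi>s)"
    using exact unfolding exact_solver_def by (elim conjE)
  ultimately show ?thesis using assms(1) unfolding solution_def by blast
qed

lemma solution_feasible: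
  assumes "c \<in> capacities" "z \<in> space (fresh_law s)"
  shows "length (solution s c z) = s" "\<And>i. i < s \<Longrightarrow> solution s c z ! i \<in> Delta m"
    "\<And>k. (\<Sum>i<s. consumption m (fst z i) (solution s c z ! i) $ k) \<le> c $ k"
proof -
  have f: "solution s c z \<in> feasible m c (map (fst z) [0..<s])"
    using solution_optimal[OF assms] by (simp add: optimal_def)
  then show len: "length (solution s c z) = s" by (simp add: feasible_def)
  show "\<And>i. i < s \<Longrightarrow> solution s c z ! i \<in> Delta m"
    using f len by (force simp: feasible_def dest: nth_mem)
  show "\<And>k. (\<Sum>i<s. consumption m (fst z i) (solution s c z ! i) $ k) \<le> c $ k"
    using f by (simp add: feasible_def)
qed

lemma payoff_measurable:
  assumes \<phi>: "(\<lambda>z. \<phi> (fst z) (snd z)) \<in> borel_measurable (item_space m \<Otimes>\<^sub>M count_space UNIV)"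
    and i: "i < s"
  shows "(\<lambda>(c, z). \<phi> (fst z i) (solution s c z ! i) :: real) \<in>
    borel_measurable (restrict_space borel capacities \<Otimes>\<^sub>M fresh_law s)"
proof -
  have 1: "(\<lambda>w. fst (snd w) i) \<in> restrict_space borel capacities \<Otimes>\<^sub>M fresh_law s \<rightarrow>\<^sub>M D"
    using i by (intro measurable_compose[OF measurable_compose[OF measurable_snd measurable_fst]
          measurable_component_singleton]) simp
  have 2: "(\<lambda>w. solution s (fst w) (snd w) ! i) \<in>
      restrict_space borel capacities \<Otimes>\<^sub>M fresh_law s \<rightarrow>\<^sub>M count_space UNIV"
    using measurable_compose[OF solution_measurable, of "\<lambda>xs. xs ! i"] by (simp add: split_beta')
  have "sets (D \<Otimes>\<^sub>M count_space UNIV) = sets (item_space m \<Otimes>\<^sub>M (count_space UNIV :: decision measure))"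
    by (intro sets_pair_measure_cong sets_D refl)
  then have "borel_measurable (D \<Otimes>\<^sub>M count_space UNIV) =
      (borel_measurable (item_space m \<Otimes>\<^sub>M count_space UNIV) :: ('d item \<times> decision \<Rightarrow> real) set)"
    by (rule measurable_cong_sets) (rule refl)
  with \<phi> have "(\<lambda>z. \<phi> (fst z) (snd z)) \<in> borel_measurable (D \<Otimes>\<^sub>M count_space UNIV)"
    by blast
  from measurable_compose[OF measurable_Pair[OF 1 2] this]
  show ?thesis by (simp add: split_beta')
qed

lemma payoff_measurable_fixed:
  assumes \<phi>: "(\<lambda>z. \<phi> (fst z) (snd z)) \<in> borel_measurable (item_space m \<Otimes>\<^sub>M count_space UNIV)"
    and i: "i < s" and c: "c \<in> capacities"
  shows "(\<lambda>z. \<phi> (fst z i) (solution s c z ! i) :: real) \<in> borel_measurable (fresh_law s)"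
proof -
  have "(\<lambda>z. (c, z)) \<in> fresh_law s \<rightarrow>\<^sub>M restrict_space borel capacities \<Otimes>\<^sub>M fresh_law s"
    using c by (intro measurable_Pair measurable_const) (auto simp: space_restrict_space)
  from measurable_compose[OF this payoff_measurable[OF \<phi> i]] show ?thesis by simp
qed

lemma integrable_fresh_component:
  assumes "integrable D f" "i < s"
  shows "integrable (fresh_law s) (\<lambda>z. f (fst z i) :: real)"
proof -
  interpret U: prob_space U by (rule prob_U)
  have "integrable (distr (fresh_law s) (samples {..<s}) fst) (\<lambda>y. f (y i))"
    unfolding U.distr_pair_fst using assms by (intro integrable_component) auto
  then show ?thesis
    by (rule integrable_distr[OF measurable_fst])
qed

lemma payoff_integrable:
  assumes \<phi>: "(\<lambda>z. \<phi> (fst z) (snd z)) \<in> borel_measurable (item_space m \<Otimes>\<^sub>M count_space UNIV)"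
    and G: "integrable D G" "\<And>\<xi> x. \<xi> \<in> items m \<Longrightarrow> x \<in> Delta m \<Longrightarrow> \<bar>\<phi> \<xi> x\<bar> \<le> G \<xi>"
    and i: "i < s" and c: "c \<in> capacities"
  shows "integrable (fresh_law s) (\<lambda>z. \<phi> (fst z i) (solution s c z ! i) :: real)"
proof (rule Bochner_Integration.integrable_bound)
  show "integrable (fresh_law s) (\<lambda>z. G (fst z i))"
    using G i by (intro integrable_fresh_component)
  show "AE z in fresh_law s. norm (\<phi> (fst z i) (solution s c z ! i)) \<le> norm (G (fst z i))"
  proof (rule AE_I2)
    fix z assume z: "z \<in> space (fresh_law s)"
    then have "fst z i \<in> items m" using i samples_items[of "fst z" "{..<s}"] by (auto simp: space_pair_measure)
    from G(2)[OF this solution_feasible(2)[OF c z i]]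
    show "norm (\<phi> (fst z i) (solution s c z ! i)) \<le> norm (G (fst z i))" by simp
  qed
qed (rule payoff_measurable_fixed[OF \<phi> i c])

text \<open>
The joint law of an item and its decision is the same in every position: transposing positions \<open>0\<close>
and \<open>i\<close> preserves the law of the items, and by equivariance, integrated over the seed, it transposes
the decisions too.
\<close>

lemma payoff_exchangeable:
  assumes \<phi>: "(\<lambda>z. \<phi> (fst z) (snd z)) \<in> borel_measurable (item_space m \<Otimes>\<^sub>M count_space UNIV)"
    and G: "integrable D G" "\<And>\<xi> x. \<xi> \<in> items m \<Longrightarrow> x \<in> Delta m \<Longrightarrow> \<bar>\<phi> \<xi> x\<bar> \<le> G \<xi>"
    and i: "i < s" and c: "c \<in> capacities"
  shows "(\<integral>z. \<phi> (fst z 0) (solution s c z ! 0) \<partial>fresh_law s) =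
    (\<integral>z. \<phi> (fst z i) (solution s c z ! i) \<partial>fresh_law s :: real)"
proof -
  interpret U: prob_space U by (rule prob_U)
  interpret Y: prob_space "samples {..<s}" by (rule prob_samples)
  interpret YU: pair_sigma_finite "samples {..<s}" U ..
  have s: "0 < s" using i by simp
  define p where "p = Transposition.transpose 0 i"
  have p: "p permutes {..<s}" unfolding p_def using i by (intro permutes_swap_id) auto
  have p0: "p 0 = i" by (simp add: p_def)
  let ?h = "\<lambda>y. \<lambda>n\<in>{..<s}. y (p n)"
  have pin: "p n < s" if "n < s" for n using permutes_in_image[OF p, of n] that by simp
  have d: "distr (samples {..<s}) (samples {..<s}) ?h = samples {..<s}"
    by (rule distr_PiM_reindex[of "{..<s}" "\<lambda>_. D" p "{..<s}", OF prob_D permutes_inj_on[OF p]])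
      (simp add: Pi_iff pin)
  have h: "?h \<in> samples {..<s} \<rightarrow>\<^sub>M samples {..<s}"
    using pin by (intro measurable_restrict measurable_component_singleton) auto
  define f where "f i y = (\<integral>u. \<phi> (y i) (solution s c (y, u) ! i) \<partial>U)" for i y
  have int: "integrable (fresh_law s) (\<lambda>z. \<phi> (fst z i) (solution s c z ! i))" if "i < s" for i
    by (rule payoff_integrable[OF \<phi> G that c])
  have fub: "(\<integral>z. \<phi> (fst z i) (solution s c z ! i) \<partial>fresh_law s) = (\<integral>y. f i y \<partial>samples {..<s})"
    if "i < s" for i
    unfolding f_def using YU.integral_fst'[OF int[OF that]] by simp
  have fmeas: "f 0 \<in> borel_measurable (samples {..<s})"
    unfolding f_def using payoff_measurable_fixed[OF \<phi> s c]
    by (intro U.borel_measurable_lebesgue_integral) (simp add: split_beta')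
  have "(\<integral>y. f 0 y \<partial>samples {..<s}) = (\<integral>y. f 0 y \<partial>distr (samples {..<s}) (samples {..<s}) ?h)"
    by (simp only: d)
  also have "\<dots> = (\<integral>y. f 0 (?h y) \<partial>samples {..<s})"
    using h fmeas by (subst integral_distr) auto
  also have "\<dots> = (\<integral>y. f i y \<partial>samples {..<s})"
  proof (intro Bochner_Integration.integral_cong refl)
    fix y assume y: "y \<in> space (samples {..<s})"
    let ?l = "map y [0..<s]"
    have items: "set ?l \<subseteq> items m" using samples_items[OF y] by auto
    have perm: "map (?h y) [0..<s] = permute_list p ?l"
      using pin by (intro nth_equalityI) (auto simp: permute_list_def)
    have ms: "sol m c l \<in> U \<rightarrow>\<^sub>M count_space UNIV" if "l = map y [0..<s]" "y \<in> space (samples {..<s})" for l y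
      using measurable_compose[OF _ solution_measurable_fixed[OF c, of s], of "\<lambda>u. (y, u)" U] that
      by (simp add: solution_def)
    \<comment> \<open>Equivariance concerns laws over the seed, hence the passage through distributions of solutions.\<close>
    have hy: "?h y \<in> space (samples {..<s})" using measurable_space[OF h y] .
    have m1: "sol m c (permute_list p ?l) \<in> U \<rightarrow>\<^sub>M count_space UNIV"
      by (rule ms[OF perm[symmetric] hy])
    have m2: "(\<lambda>u. permute_list p (sol m c ?l u)) \<in> U \<rightarrow>\<^sub>M count_space UNIV"
      by (rule measurable_compose[OF ms[OF refl y]]) simp
    have eq: "distr U (count_space UNIV) (sol m c (permute_list p ?l)) =
        distr U (count_space UNIV) (\<lambda>u. permute_list p (sol m c ?l u))"
      using equivariant c items p unfolding equivariant_def by simp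
    have "f 0 (?h y) = (\<integral>u. \<phi> (y i) (sol m c (permute_list p ?l) u ! 0) \<partial>U)"
      unfolding f_def solution_def fst_conv snd_conv perm using s p0 by simp
    also have "\<dots> = (\<integral>xs. \<phi> (y i) (xs ! 0) \<partial>distr U (count_space UNIV) (sol m c (permute_list p ?l)))"
      by (subst integral_distr[OF m1]) auto
    also have "\<dots> = (\<integral>u. \<phi> (y i) (permute_list p (sol m c ?l u) ! 0) \<partial>U)"
      unfolding eq by (subst integral_distr[OF m2]) auto
    also have "\<dots> = f i y"
      unfolding f_def
    proof (intro Bochner_Integration.integral_cong refl)
      fix u assume "u \<in> space U"
      with y have "(y, u) \<in> space (fresh_law s)" by (simp add: space_pair_measure)
      from solution_feasible(1)[OF c this] s p0
      show "\<phi> (y i) (permute_list p (sol m c ?l u) ! 0) = \<phi> (y i) (solution s c (y, u) ! i)"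
        by (simp add: permute_list_def solution_def)
    qed
    finally show "f 0 (?h y) = f i y" .
  qed
  finally show ?thesis using fub[OF i] fub[OF s] by simp
qed

lemma payoff_average:
  assumes \<phi>: "(\<lambda>z. \<phi> (fst z) (snd z)) \<in> borel_measurable (item_space m \<Otimes>\<^sub>M count_space UNIV)"
    and G: "integrable D G" "\<And>\<xi> x. \<xi> \<in> items m \<Longrightarrow> x \<in> Delta m \<Longrightarrow> \<bar>\<phi> \<xi> x\<bar> \<le> G \<xi>"
    and s: "0 < s" and c: "c \<in> capacities"
  shows "(\<integral>z. \<phi> (fst z 0) (solution s c z ! 0) \<partial>fresh_law s) =
    (\<integral>z. (\<Sum>i<s. \<phi> (fst z i) (solution s c z ! i)) \<partial>fresh_law s) / real s"
proof -
  have "(\<integral>z. (\<Sum>i<s. \<phi> (fst z i) (solution s c z ! i)) \<partial>fresh_law s) =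
      (\<Sum>i<s. \<integral>z. \<phi> (fst z i) (solution s c z ! i) \<partial>fresh_law s)"
    by (intro Bochner_Integration.integral_sum payoff_integrable[OF \<phi> G _ c]) auto
  also have "\<dots> = (\<Sum>i<s. \<integral>z. \<phi> (fst z 0) (solution s c z ! 0) \<partial>fresh_law s)"
    by (intro sum.cong refl payoff_exchangeable[OF \<phi> G _ c, symmetric]) auto
  finally show ?thesis using s by simp
qed

lemma expected_gain:
  assumes "0 < s" "c \<in> capacities"
  shows "(\<integral>z. reward m (fst z 0) (solution s c z ! 0) \<partial>fresh_law s) = V s c / real s"
proof -
  interpret U: prob_space U by (rule prob_U)
  have "(\<integral>z. (\<Sum>i<s. reward m (fst z i) (solution s c z ! i)) \<partial>fresh_law s) =
      (\<integral>z. OPT m c (map (fst z) [0..<s]) \<partial>fresh_law s)"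
  proof (intro Bochner_Integration.integral_cong refl)
    fix z assume "z \<in> space (fresh_law s)"
    from optimal_total_reward[OF solution_optimal[OF assms(2) this]]
    show "(\<Sum>i<s. reward m (fst z i) (solution s c z ! i)) = OPT m c (map (fst z) [0..<s])"
      by (simp add: total_reward_def)
  qed
  also have "\<dots> = (\<integral>y. OPT m c (map y [0..<s]) \<partial>distr (fresh_law s) (samples {..<s}) fst)"
    using OPT_measurable[OF assms(2), of "[0..<s]" "{..<s}"] by (subst integral_distr) (auto simp: subset_eq)
  also have "\<dots> = V s c" unfolding V_def by (simp only: U.distr_pair_fst)
  finally show ?thesis
    using payoff_average[OF reward_measurable integrable_reward_size reward_le_size assms] by simp
qed

definition consumption_size :: "'d \<Rightarrow> 'd item \<Rightarrow> real" where
  "consumption_size k \<xi> = (\<Sum>j<m. snd \<xi> j $ k)"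

lemma integrable_consumption_size: "integrable D (consumption_size k)"
  unfolding consumption_size_def
proof (intro Bochner_Integration.integrable_sum)
  interpret prob_space D by (rule prob_D)
  fix j assume j: "j \<in> {..<m}"
  show "integrable D (\<lambda>\<xi>. snd \<xi> j $ k)"
  proof (rule integrable_const_bound[where B="b $ k / N"])
    show "AE \<xi> in D. norm (snd \<xi> j $ k) \<le> b $ k / N"
      using small AE_space
    proof eventually_elim
      case (elim \<xi>)
      then have "0 \<le> snd \<xi> j $ k" "N * snd \<xi> j $ k \<le> b $ k"
        using j by (auto simp: space_D items_def)
      then show ?case using N_pos by (simp add: field_simps)
    qed
    show "(\<lambda>\<xi>. snd \<xi> j $ k) \<in> borel_measurable D"
      unfolding measurable_cong_sets[OF sets_D refl] by (rule snd_item_measurable)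
  qed
qed

lemma consumption_le_size:
  assumes "\<xi> \<in> items m" "x \<in> Delta m"
  shows "\<bar>consumption m \<xi> x $ k\<bar> \<le> consumption_size k \<xi>"
proof -
  have "consumption m \<xi> x $ k \<le> consumption_size k \<xi>"
    unfolding consumption_def consumption_size_def vec_lambda_beta
  proof (intro sum_mono)
    fix j assume "j \<in> {..<m}"
    then have "0 \<le> snd \<xi> j $ k" using assms(1) by (auto simp: items_def)
    then show "snd \<xi> j $ k * x j \<le> snd \<xi> j $ k"
      using Delta_cases[OF assms(2), of j] by auto
  qed
  then show ?thesis using consumption_nonneg[OF assms, of k] by simp
qed

text \<open>
The uses of all \<open>s\<close> items sum up to at most \<open>c\<close>, and each has the same mean.
\<close>

lemma expected_use:
  assumes "0 < s" "c \<in> capacities"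
  shows "(\<integral>z. consumption m (fst z 0) (solution s c z ! 0) $ k \<partial>fresh_law s) \<le> c $ k / real s"
proof -
  interpret prob_space "fresh_law s" by (rule prob_fresh)
  have "(\<integral>z. (\<Sum>i<s. consumption m (fst z i) (solution s c z ! i) $ k) \<partial>fresh_law s)
      \<le> (\<integral>z. c $ k \<partial>fresh_law s)"
    using solution_feasible(3)[OF assms(2)]
    by (intro Bochner_Integration.integral_mono Bochner_Integration.integrable_sum
        payoff_integrable[OF consumption_measurable integrable_consumption_size consumption_le_size] assms) auto
  then show ?thesis
    using assms(1) payoff_average[OF consumption_measurable integrable_consumption_size consumption_le_size assms]
    by (simp add: divide_right_mono prob_space)
qed

lemma use_le_capacity:
  assumes "0 < s" "c \<in> capacities" "z \<in> space (fresh_law s)"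
  shows "consumption m (fst z 0) (solution s c z ! 0) $ k \<le> c $ k"
    "0 \<le> consumption m (fst z 0) (solution s c z ! 0) $ k"
proof -
  have items: "fst z i \<in> items m" if "i < s" for i
    using assms(3) that samples_items[of "fst z" "{..<s}"] by (auto simp: space_pair_measure)
  have nn: "0 \<le> consumption m (fst z i) (solution s c z ! i) $ k" if "i < s" for i
    using that by (intro consumption_nonneg items solution_feasible(2)[OF assms(2,3)])
  then show "0 \<le> consumption m (fst z 0) (solution s c z ! 0) $ k" using assms(1) .
  have "consumption m (fst z 0) (solution s c z ! 0) $ k \<le>
      (\<Sum>i<s. consumption m (fst z i) (solution s c z ! i) $ k)"
    using nn assms(1) by (intro member_le_sum) auto
  also have "\<dots> \<le> c $ k" by (rule solution_feasible(3)[OF assms(2,3)])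
  finally show "consumption m (fst z 0) (solution s c z ! 0) $ k \<le> c $ k" .
qed

lemma use_small:
  assumes "0 < s" "c \<in> capacities"
  shows "AE z in fresh_law s. N * consumption m (fst z 0) (solution s c z ! 0) $ k \<le> b $ k"
proof -
  interpret U: prob_space U by (rule prob_U)
  have "AE y in distr (fresh_law s) (samples {..<s}) fst. \<forall>j<m. \<forall>k. N * snd (y 0) j $ k \<le> b $ k"
    unfolding U.distr_pair_fst using assms by (intro AE_PiM_component[where P="\<lambda>\<xi>. \<forall>j<m. \<forall>k. N * snd \<xi> j $ k \<le> b $ k"]
        prob_D small) auto
  then have "AE z in fresh_law s. \<forall>j<m. \<forall>k. N * snd (fst z 0) j $ k \<le> b $ k"
    by (rule AE_distrD[OF measurable_fst])
  then show ?thesis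
    using AE_space
  proof eventually_elim
    case (elim z)
    then show ?case
      using solution_feasible(2)[OF assms(2) elim(2) assms(1)] b
      by (intro consumption_le) (auto simp: capacities_def)
  qed
qed

end

section \<open>The remaining capacity\<close>

text \<open>
One step of the second-moment recursion: \<open>c\<close> is the capacity left for \<open>s\<close> periods and \<open>X\<close> the use
in the current one. As the mean of \<open>X\<close> is at most \<open>c / s\<close>, the shortfall below \<open>\<beta>\<close> of the capacity
per period grows by no more than the centred quantity \<open>(X - E X) / (s - 1)\<close>, whose variance is at
most \<open>E X\<^sup>2 / (s - 1)\<^sup>2\<close>, and \<open>X\<^sup>2 \<le> (C / N) X\<close>.
\<close>

lemma (in prob_space) shortfall_step:
  fixes X :: "'a \<Rightarrow> real"
  assumes X: "X \<in> borel_measurable M" "AE x in M. 0 \<le> X x" "AE x in M. N * X x \<le> C"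
    and N: "0 < N" and s: "1 < s" and mean: "expectation X \<le> c / s"
  shows "expectation (\<lambda>x. (max 0 (\<beta> - (c - X x) / (s - 1)))\<^sup>2) \<le>
    (max 0 (\<beta> - c / s))\<^sup>2 + C / N * expectation X / (s - 1)\<^sup>2"
proof -
  define \<mu> where "\<mu> = expectation X"
  define z where "z = max 0 (\<beta> - c / s)"
  have bound: "AE x in M. 0 \<le> X x \<and> X x \<le> C / N"
    using X(2,3) by eventually_elim (use N in \<open>simp add: field_simps\<close>)
  have intX: "integrable M X"
    using bound by (intro integrable_const_bound[where B="C / N"] X(1)) auto
  have intX2: "integrable M (\<lambda>x. (X x)\<^sup>2)"
  proof (rule integrable_const_bound[where B="(C / N)\<^sup>2"])
    show "AE x in M. norm ((X x)\<^sup>2) \<le> (C / N)\<^sup>2"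
      using bound by eventually_elim (simp add: power_mono)
  qed (use X(1) in measurable)
  have second: "expectation (\<lambda>x. (X x)\<^sup>2) \<le> C / N * \<mu>"
  proof -
    have "expectation (\<lambda>x. (X x)\<^sup>2) \<le> expectation (\<lambda>x. C / N * X x)"
    proof (rule integral_mono_AE[OF intX2])
      show "AE x in M. (X x)\<^sup>2 \<le> C / N * X x"
        using bound by eventually_elim (simp only: power2_eq_square mult_right_mono)
    qed (use intX in simp)
    then show ?thesis by (simp add: \<mu>_def)
  qed
  have step: "(max 0 (\<beta> - (c - x) / (s - 1)))\<^sup>2 \<le> (z + (x - \<mu>) / (s - 1))\<^sup>2" for x
  proof -
    have "(c - x) / (s - 1) = c / s + (c / s - x) / (s - 1)"
      using s by (simp add: divide_simps) (simp add: algebra_simps)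
    moreover have "(\<mu> - x) / (s - 1) \<le> (c / s - x) / (s - 1)"
      using mean s unfolding \<mu>_def by (intro divide_right_mono) auto
    ultimately have "\<beta> - (c - x) / (s - 1) \<le> \<beta> - c / s - (\<mu> - x) / (s - 1)" by simp
    also have "\<dots> \<le> z + (x - \<mu>) / (s - 1)"
      unfolding z_def by (simp add: diff_divide_distrib)
    finally show ?thesis
      by (cases "0 \<le> \<beta> - (c - x) / (s - 1)") (auto intro!: power_mono)
  qed
  have expand: "(z + (X x - \<mu>) / (s - 1))\<^sup>2 =
      z\<^sup>2 + 2 * z / (s - 1) * (X x - \<mu>) + ((X x)\<^sup>2 - 2 * \<mu> * X x + \<mu>\<^sup>2) / (s - 1)\<^sup>2" for x
    using s by (simp add: power2_eq_square divide_simps) (simp add: algebra_simps)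
  have int: "integrable M (\<lambda>x. (z + (X x - \<mu>) / (s - 1))\<^sup>2)"
    unfolding expand using intX intX2 by (intro Bochner_Integration.integrable_add
        Bochner_Integration.integrable_diff integrable_mult_right integrable_divide integrable_const)
  have "expectation (\<lambda>x. (max 0 (\<beta> - (c - X x) / (s - 1)))\<^sup>2) \<le> expectation (\<lambda>x. (z + (X x - \<mu>) / (s - 1))\<^sup>2)"
  proof (rule Bochner_Integration.integral_mono[OF _ int step])
    have m: "(\<lambda>x. (max 0 (\<beta> - (c - X x) / (s - 1)))\<^sup>2) \<in> borel_measurable M"
      using X(1) by measurable
    show "integrable M (\<lambda>x. (max 0 (\<beta> - (c - X x) / (s - 1)))\<^sup>2)"
      by (rule Bochner_Integration.integrable_bound[OF int m]) (auto intro!: AE_I2 step)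
  qed
  also have "\<dots> = z\<^sup>2 + (expectation (\<lambda>x. (X x)\<^sup>2) - \<mu>\<^sup>2) / (s - 1)\<^sup>2"
    unfolding expand using intX intX2
    by (simp add: prob_space \<mu>_def[symmetric]) (simp add: power2_eq_square algebra_simps)
  also have "\<dots> \<le> z\<^sup>2 + (C / N * \<mu>) / (s - 1)\<^sup>2"
    using second zero_le_power2[of \<mu>] by (intro add_left_mono divide_right_mono) (linarith, simp)
  finally show ?thesis by (simp add: z_def \<mu>_def)
qed

lemma borel_measurable_vecI:
  fixes f :: "'a \<Rightarrow> real ^ 'd::finite"
  assumes "\<And>k. (\<lambda>x. f x $ k) \<in> borel_measurable M"
  shows "f \<in> borel_measurable M"
proof (rule borel_measurable_euclidean_space[THEN iffD2], rule ballI)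
  fix i :: "real ^ 'd" assume "i \<in> Basis"
  then obtain k where "i = axis k 1" by (auto simp: Basis_vec_def)
  then show "(\<lambda>x. f x \<bullet> i) \<in> borel_measurable M"
    using assms[of k] by (simp add: inner_axis)
qed

lemma capacity_component_measurable:
  "(\<lambda>c. c $ k) \<in> borel_measurable (restrict_space borel (capacities :: (real ^ 'd::finite) set))"
  by (intro measurable_restrict_space1 borel_measurable_continuous_onI continuous_on_component continuous_on_id)

type_synonym ('d, 'u) scenario = "(nat \<Rightarrow> 'd item) \<times> (nat \<times> nat \<Rightarrow> 'd item) \<times> (nat \<Rightarrow> 'u)"

lemma length_oso: "length (oso sol m b T \<xi> \<zeta> u t) = t"
  by (induction t) (simp_all add: Let_def)

lemma oso_nth_stable: "\<tau> < t \<Longrightarrow> oso sol m b T \<xi> \<zeta> u t ! \<tau> = oso sol m b T \<xi> \<zeta> u (Suc \<tau>) ! \<tau>"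
proof (induction t)
  case (Suc t)
  then show ?case
    by (cases "\<tau> = t") (simp_all add: Let_def nth_append length_oso)
qed simp

text \<open>
The pairs (period of the call, future period) of the samples drawn before period \<open>t\<close>.
\<close>

definition sample_index :: "nat \<Rightarrow> nat \<Rightarrow> (nat \<times> nat) set" where
  "sample_index T t = {(t', \<tau>). t' < t \<and> t' < \<tau> \<and> \<tau> < T}"

lemma finite_sample_index: "finite (sample_index T t)"
  by (rule finite_subset[of _ "{..<t} \<times> {..<T}"]) (auto simp: sample_index_def)

lemma oso_cong:
  assumes "\<And>\<tau>. \<tau> < t \<Longrightarrow> \<xi> \<tau> = \<xi>' \<tau>" "\<And>p. p \<in> sample_index T t \<Longrightarrow> \<zeta> p = \<zeta>' p"
    "\<And>\<tau>. \<tau> < t \<Longrightarrow> u \<tau> = u' \<tau>"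
  shows "oso sol m b T \<xi> \<zeta> u t = oso sol m b T \<xi>' \<zeta>' u' t"
  using assms
proof (induction t)
  case (Suc t)
  have IH: "oso sol m b T \<xi> \<zeta> u t = oso sol m b T \<xi>' \<zeta>' u' t"
    by (rule Suc.IH) (use Suc.prems in \<open>auto simp: sample_index_def\<close>)
  have samples: "map (\<lambda>\<tau>. \<zeta> (t, \<tau>)) [Suc t..<T] = map (\<lambda>\<tau>. \<zeta>' (t, \<tau>)) [Suc t..<T]"
    using Suc.prems(2) by (auto simp: sample_index_def)
  have cons: "(\<Sum>\<tau><t. consumption m (\<xi> \<tau>) (oso sol m b T \<xi>' \<zeta>' u' t ! \<tau>)) =
      (\<Sum>\<tau><t. consumption m (\<xi>' \<tau>) (oso sol m b T \<xi>' \<zeta>' u' t ! \<tau>))"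
    using Suc.prems(1) by (intro sum.cong) auto
  have "\<xi> t = \<xi>' t" "u t = u' t" using Suc.prems by auto
  then show ?case
    by (simp only: oso.simps IH samples cons Let_def)
qed simp

context online_allocation
begin

definition cap :: "nat \<Rightarrow> nat \<Rightarrow> ('d, 'u) scenario \<Rightarrow> real ^ 'd" where
  "cap T t = (\<lambda>(\<xi>, \<zeta>, u). b - (\<Sum>\<tau><t. consumption m (\<xi> \<tau>) (oso sol m b T \<xi> \<zeta> u t ! \<tau>)))"

text \<open>
The input of the solver call in period \<open>t\<close>: the arriving item at position \<open>0\<close>, followed by the
samples, and the seed.
\<close>

definition fresh :: "nat \<Rightarrow> nat \<Rightarrow> ('d, 'u) scenario \<Rightarrow> (nat \<Rightarrow> 'd item) \<times> 'u" where
  "fresh T t = (\<lambda>(\<xi>, \<zeta>, u). (\<lambda>i\<in>{..<T - t}. if i = 0 then \<xi> t else \<zeta> (t, t + i), u t))"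

definition past :: "nat \<Rightarrow> nat \<Rightarrow> ('d, 'u) scenario \<Rightarrow> ('d, 'u) scenario" where
  "past T t = (\<lambda>(\<xi>, \<zeta>, u). (restrict \<xi> {..<t}, restrict \<zeta> (sample_index T t), restrict u {..<t}))"

definition past_law :: "nat \<Rightarrow> nat \<Rightarrow> ('d, 'u) scenario measure" where
  "past_law T t = samples {..<t} \<Otimes>\<^sub>M samples (sample_index T t) \<Otimes>\<^sub>M (\<Pi>\<^sub>M \<tau>\<in>{..<t}. U)"

lemma prob_past: "prob_space (past_law T t)"
  unfolding past_law_def by (intro prob_space_pair prob_samples prob_space_PiM prob_U)

lemma cap_0: "cap T 0 \<omega> = b"
  by (simp add: cap_def split_beta')

lemma cap_past: "cap T t (past T t \<omega>) = cap T t \<omega>"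
proof -
  obtain \<xi> \<zeta> u where \<omega>: "\<omega> = (\<xi>, \<zeta>, u)" by (cases \<omega>) auto
  have "oso sol m b T (restrict \<xi> {..<t}) (restrict \<zeta> (sample_index T t)) (restrict u {..<t}) t =
      oso sol m b T \<xi> \<zeta> u t"
    by (rule oso_cong) auto
  then show ?thesis by (simp add: cap_def past_def \<omega>)
qed

lemma fresh_measurable:
  assumes "t < t'" "t' \<le> T"
  shows "fresh T t \<in> past_law T t' \<rightarrow>\<^sub>M fresh_law (T - t)"
proof -
  have "(\<lambda>\<omega>. if i = 0 then fst \<omega> t else fst (snd \<omega>) (t, t + i)) \<in> past_law T t' \<rightarrow>\<^sub>M D"
    if "i \<in> {..<T - t}" for i
  proof (cases "i = 0")
    case True
    have "(\<lambda>\<omega>. fst \<omega> t) \<in> past_law T t' \<rightarrow>\<^sub>M D"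
      unfolding past_law_def using assms
      by (intro measurable_compose[OF measurable_fst measurable_component_singleton]) auto
    then show ?thesis using True by simp
  next
    case False
    have "(\<lambda>\<omega>. fst (snd \<omega>) (t, t + i)) \<in> past_law T t' \<rightarrow>\<^sub>M D"
      unfolding past_law_def using assms that False
      by (intro measurable_compose[OF measurable_compose[OF measurable_snd measurable_fst]
            measurable_component_singleton]) (auto simp: sample_index_def)
    then show ?thesis using False by simp
  qed
  moreover have "(\<lambda>\<omega>. snd (snd \<omega>) t) \<in> past_law T t' \<rightarrow>\<^sub>M U"
    unfolding past_law_def using assms
    by (intro measurable_compose[OF measurable_compose[OF measurable_snd measurable_snd]
          measurable_component_singleton]) auto
  ultimately show ?thesis
    unfolding fresh_def split_beta' by (intro measurable_Pair measurable_restrict)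
qed

lemma oso_step:
  assumes t: "t < T" and c: "cap T t (\<xi>, \<zeta>, u) \<in> capacities"
    and f: "fresh T t (\<xi>, \<zeta>, u) \<in> space (fresh_law (T - t))"
  shows "oso sol m b T \<xi> \<zeta> u (Suc t) ! t =
    solution (T - t) (cap T t (\<xi>, \<zeta>, u)) (fresh T t (\<xi>, \<zeta>, u)) ! 0"
proof -
  let ?c = "cap T t (\<xi>, \<zeta>, u)"
  have list: "\<xi> t # map (\<lambda>\<tau>. \<zeta> (t, \<tau>)) [Suc t..<T] = map (fst (fresh T t (\<xi>, \<zeta>, u))) [0..<T - t]"
    using t by (intro nth_equalityI) (auto simp: fresh_def nth_Cons split: nat.split)
  have "oso sol m b T \<xi> \<zeta> u (Suc t) ! t =
      hd (sol m ?c (\<xi> t # map (\<lambda>\<tau>. \<zeta> (t, \<tau>)) [Suc t..<T]) (u t))"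
    by (simp add: Let_def nth_append length_oso cap_def)
  also have "\<dots> = hd (solution (T - t) ?c (fresh T t (\<xi>, \<zeta>, u)))"
    unfolding list solution_def by (simp add: fresh_def)
  also have "\<dots> = solution (T - t) ?c (fresh T t (\<xi>, \<zeta>, u)) ! 0"
    using solution_feasible(1)[OF c f] t by (intro hd_conv_nth) auto
  finally show ?thesis .
qed

definition period_use :: "nat \<Rightarrow> real ^ 'd \<Rightarrow> (nat \<Rightarrow> 'd item) \<times> 'u \<Rightarrow> real ^ 'd" where
  "period_use s c z = consumption m (fst z 0) (solution s c z ! 0)"

lemma cap_Suc:
  assumes t: "t < T" and c: "cap T t \<omega> \<in> capacities" and f: "fresh T t \<omega> \<in> space (fresh_law (T - t))"
  shows "cap T (Suc t) \<omega> = cap T t \<omega> - period_use (T - t) (cap T t \<omega>) (fresh T t \<omega>)"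
proof -
  obtain \<xi> \<zeta> u where \<omega>: "\<omega> = (\<xi>, \<zeta>, u)" by (cases \<omega>) auto
  have eq: "(\<Sum>\<tau><t. consumption m (\<xi> \<tau>) (oso sol m b T \<xi> \<zeta> u (Suc t) ! \<tau>)) =
      (\<Sum>\<tau><t. consumption m (\<xi> \<tau>) (oso sol m b T \<xi> \<zeta> u t ! \<tau>))"
    by (intro sum.cong refl arg_cong[where f="consumption m _"])
      (metis lessThan_iff less_SucI oso_nth_stable)
  have "fst (fresh T t \<omega>) 0 = \<xi> t" using t by (simp add: fresh_def \<omega>)
  then show ?thesis
    using oso_step[OF t] c f eq by (simp add: cap_def period_use_def \<omega> algebra_simps del: oso.simps)
qed

lemma cap_measurable:
  assumes "t \<le> t'" "t' \<le> T"
  shows "cap T t \<in> past_law T t' \<rightarrow>\<^sub>M restrict_space borel capacities"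
    and "\<And>\<omega> k. \<omega> \<in> space (past_law T t') \<Longrightarrow> cap T t \<omega> $ k \<le> b $ k"
proof -
  have "cap T t \<in> past_law T t' \<rightarrow>\<^sub>M restrict_space borel capacities \<and>
      (\<forall>\<omega>\<in>space (past_law T t'). \<forall>k. cap T t \<omega> $ k \<le> b $ k)"
    using assms(1)
  proof (induction t)
    case 0
    have "(\<lambda>_. b) \<in> past_law T t' \<rightarrow>\<^sub>M restrict_space borel capacities"
      using b by (intro measurable_const) (simp add: space_restrict_space)
    moreover have "cap T 0 = (\<lambda>_. b)" by (rule ext) (rule cap_0)
    ultimately show ?case by simp
  next
    case (Suc t)
    then have t: "t < t'" "t < T" using assms(2) by auto
    have IH: "cap T t \<in> past_law T t' \<rightarrow>\<^sub>M restrict_space borel capacities"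
      "\<And>\<omega> k. \<omega> \<in> space (past_law T t') \<Longrightarrow> cap T t \<omega> $ k \<le> b $ k"
      using Suc by auto
    have fm: "fresh T t \<in> past_law T t' \<rightarrow>\<^sub>M fresh_law (T - t)"
      by (rule fresh_measurable[OF t(1) assms(2)])
    have c: "cap T t \<omega> \<in> capacities" and f: "fresh T t \<omega> \<in> space (fresh_law (T - t))"
      if "\<omega> \<in> space (past_law T t')" for \<omega>
      using measurable_space[OF IH(1) that] measurable_space[OF fm that]
      by (auto simp: space_restrict_space)
    have step: "cap T (Suc t) \<omega> $ k = cap T t \<omega> $ k -
        consumption m (fst (fresh T t \<omega>) 0) (solution (T - t) (cap T t \<omega>) (fresh T t \<omega>) ! 0) $ k"
      if "\<omega> \<in> space (past_law T t')" for \<omega> k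
      using cap_Suc[OF t(2) c[OF that] f[OF that]] by (simp add: period_use_def)
    have s: "0 < T - t" using t by simp
    have "cap T (Suc t) \<in> borel_measurable (past_law T t')"
    proof (rule borel_measurable_vecI)
      fix k
      have m1: "(\<lambda>\<omega>. cap T t \<omega> $ k) \<in> borel_measurable (past_law T t')"
        by (rule measurable_compose[OF IH(1) capacity_component_measurable])
      have m2: "(\<lambda>\<omega>. consumption m (fst (fresh T t \<omega>) 0)
          (solution (T - t) (cap T t \<omega>) (fresh T t \<omega>) ! 0) $ k) \<in> borel_measurable (past_law T t')"
        using measurable_compose[OF measurable_Pair[OF IH(1) fm] payoff_measurable[OF consumption_measurable s]]
        by simp
      from borel_measurable_diff[OF m1 m2] show "(\<lambda>\<omega>. cap T (Suc t) \<omega> $ k) \<in> borel_measurable (past_law T t')"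
        by (rule measurable_cong[THEN iffD2, rotated]) (rule step)
    qed
    moreover have "cap T (Suc t) \<omega> \<in> capacities" if "\<omega> \<in> space (past_law T t')" for \<omega>
      using use_le_capacity(1)[OF s c[OF that] f[OF that]] step[OF that] by (simp add: capacities_def)
    moreover have "cap T (Suc t) \<omega> $ k \<le> b $ k" if "\<omega> \<in> space (past_law T t')" for \<omega> k
      using use_le_capacity(2)[OF s c[OF that] f[OF that], of k] step[OF that, of k] IH(2)[OF that, of k] by simp
    ultimately show ?case
      by (auto intro!: measurable_restrict_space2)
  qed
  then show "cap T t \<in> past_law T t' \<rightarrow>\<^sub>M restrict_space borel capacities"
    "\<And>\<omega> k. \<omega> \<in> space (past_law T t') \<Longrightarrow> cap T t \<omega> $ k \<le> b $ k" by auto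
qed

lemma cap_capacities:
  assumes "t \<le> t'" "t' \<le> T" "\<omega> \<in> space (past_law T t')"
  shows "cap T t \<omega> \<in> capacities"
  using measurable_space[OF cap_measurable(1)[OF assms(1,2)] assms(3)] by (simp add: space_restrict_space)

text \<open>
The arriving item, the samples and the seed of period \<open>t\<close> are independent of everything that
precedes, and the item list has the law of \<open>T - t\<close> i.i.d. items. The three product spaces are
split separately and then recombined.
\<close>

lemma splits_period:
  assumes t: "t < T"
  shows "splits (past_law T T) (past_law T t) (fresh_law (T - t)) (past T t) (fresh T t)"
proof -
  let ?s = "T - t" and ?J = "{p \<in> sample_index T T. fst p = t}"
  interpret D: prob_space D by (rule prob_D)
  have PU: "prob_space (\<Pi>\<^sub>M \<tau>\<in>I. U)" for I :: "nat set" by (intro prob_space_PiM prob_U)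
  have single: "distr (\<Pi>\<^sub>M i\<in>{t}. E) E (\<lambda>y. y t) = E" "(\<lambda>y. y t) \<in> (\<Pi>\<^sub>M i\<in>{t}. E) \<rightarrow>\<^sub>M E"
    if "prob_space E" for E :: "'x measure"
    using that by (auto intro: distr_PiM_component)
  have "splits (samples {..<T}) (samples {..<t}) D (\<lambda>x. restrict x {..<t}) (\<lambda>x. restrict x {t} t)"
    by (rule splits_map[OF splits_PiM single(2,1)]) (use t in \<open>auto intro: prob_D prob_samples\<close>)
  then have items: "splits (samples {..<T}) (samples {..<t}) D (\<lambda>x. restrict x {..<t}) (\<lambda>x. x t)"
    by simp
  have "splits (\<Pi>\<^sub>M \<tau>\<in>{..<T}. U) (\<Pi>\<^sub>M \<tau>\<in>{..<t}. U) U (\<lambda>x. restrict x {..<t}) (\<lambda>x. restrict x {t} t)"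
    by (rule splits_map[OF splits_PiM single(2,1)]) (use t in \<open>auto intro: prob_U PU\<close>)
  then have seeds: "splits (\<Pi>\<^sub>M \<tau>\<in>{..<T}. U) (\<Pi>\<^sub>M \<tau>\<in>{..<t}. U) U (\<lambda>x. restrict x {..<t}) (\<lambda>x. x t)"
    by simp
  let ?h = "\<lambda>x. \<lambda>i\<in>{1..<?s}. x (t, t + i)"
  have J: "(t, t + i) \<in> ?J" if "i \<in> {1..<?s}" for i
    using that by (auto simp: sample_index_def)
  have "splits (samples (sample_index T T)) (samples (sample_index T t)) (samples {1..<?s})
      (\<lambda>x. restrict x (sample_index T t)) (\<lambda>x. ?h (restrict x ?J))"
  proof (rule splits_map[OF splits_PiM])
    show "?h \<in> samples ?J \<rightarrow>\<^sub>M samples {1..<?s}"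
      by (intro measurable_restrict measurable_component_singleton J)
    show "distr (samples ?J) (samples {1..<?s}) ?h = samples {1..<?s}"
      by (rule distr_PiM_reindex[of ?J "\<lambda>_. D" "\<lambda>i. (t, t + i)" "{1..<?s}", OF prob_D])
        (use J in \<open>auto intro: inj_onI\<close>)
    show "sample_index T t \<inter> ?J = {}" "sample_index T t \<subseteq> sample_index T T"
      using t by (auto simp: sample_index_def)
  qed (use finite_sample_index[of T T] in \<open>auto intro: prob_D prob_samples finite_sample_index\<close>)
  also have "(\<lambda>x. ?h (restrict x ?J)) = ?h"
    using J by (intro ext) (auto simp: restrict_def)
  finally have future: "splits (samples (sample_index T T)) (samples (sample_index T t)) (samples {1..<?s})
      (\<lambda>x. restrict x (sample_index T t)) ?h" .
  have s: "insert 0 {1..<?s} = {..<?s}" using t by auto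
  let ?g = "\<lambda>(x, X, u). (X(0 := x), u)"
  \<comment> \<open>Prepending the arriving item to the samples yields a vector of i.i.d. items.\<close>
  have upd: "(\<lambda>(x, X). X(0 := x)) \<in> D \<Otimes>\<^sub>M samples {1..<?s} \<rightarrow>\<^sub>M samples {..<?s}"
    unfolding s[symmetric] by measurable
  have upd_distr: "distr (D \<Otimes>\<^sub>M samples {1..<?s}) (samples {..<?s}) (\<lambda>(x, X). X(0 := x)) = samples {..<?s}"
    unfolding s[symmetric] by (rule distr_pair_PiM_eq_PiM) (rule prob_D)+
  have "splits (past_law T T) (past_law T t) (D \<Otimes>\<^sub>M samples {1..<?s} \<Otimes>\<^sub>M U)
      (\<lambda>(x, y). (restrict x {..<t}, (\<lambda>(x, y). (restrict x (sample_index T t), restrict y {..<t})) y))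
      (\<lambda>(x, y). (x t, (\<lambda>(x, y). (?h x, y t)) y))"
    unfolding past_law_def
    by (intro splits_pair items future seeds prob_space_pair prob_samples prob_D prob_U PU)
  then have "splits (past_law T T) (past_law T t) (fresh_law ?s)
      (\<lambda>(x, y). (restrict x {..<t}, (\<lambda>(x, y). (restrict x (sample_index T t), restrict y {..<t})) y))
      (\<lambda>\<omega>. ?g ((\<lambda>(x, y). (x t, (\<lambda>(x, y). (?h x, y t)) y)) \<omega>))"
  proof (rule splits_map)
    have g: "?g = (\<lambda>z. ((\<lambda>(x, X). X(0 := x)) (fst z, fst (snd z)), snd (snd z)))" by auto
    show "?g \<in> D \<Otimes>\<^sub>M samples {1..<?s} \<Otimes>\<^sub>M U \<rightarrow>\<^sub>M fresh_law ?s"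
      unfolding g by (intro measurable_Pair measurable_compose[OF _ upd]) measurable
    let ?a = "\<lambda>z. ((fst z, fst (snd z)), snd (snd z)) :: ('d item \<times> (nat \<Rightarrow> 'd item)) \<times> 'u"
    let ?r = "\<lambda>(w, u). ((\<lambda>(x, X). X(0 := x)) w, u) :: (nat \<Rightarrow> 'd item) \<times> 'u"
    have r: "?r \<in> (D \<Otimes>\<^sub>M samples {1..<?s}) \<Otimes>\<^sub>M U \<rightarrow>\<^sub>M fresh_law ?s"
      unfolding split_beta'[of "\<lambda>w u. ((\<lambda>(x, X). X(0 := x)) w, u)"]
      by (intro measurable_Pair measurable_compose[OF measurable_fst upd] measurable_snd)
    have "fresh_law ?s = distr (D \<Otimes>\<^sub>M samples {1..<?s}) (samples {..<?s}) (\<lambda>(x, X). X(0 := x)) \<Otimes>\<^sub>M distr U U (\<lambda>u. u)"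
      by (simp only: upd_distr distr_id)
    also have "\<dots> = distr ((D \<Otimes>\<^sub>M samples {1..<?s}) \<Otimes>\<^sub>M U) (fresh_law ?s) ?r"
      using prob_U by (intro pair_measure_distr upd) (auto intro: prob_space_imp_sigma_finite)
    also have "\<dots> = distr (distr (D \<Otimes>\<^sub>M samples {1..<?s} \<Otimes>\<^sub>M U) ((D \<Otimes>\<^sub>M samples {1..<?s}) \<Otimes>\<^sub>M U) ?a) (fresh_law ?s) ?r"
      by (subst distr_pair_assoc) (auto intro: prob_D prob_samples prob_U)
    also have "\<dots> = distr (D \<Otimes>\<^sub>M samples {1..<?s} \<Otimes>\<^sub>M U) (fresh_law ?s) (?r \<circ> ?a)"
      by (intro distr_distr r) measurable
    also have "?r \<circ> ?a = ?g" by auto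
    finally show "distr (D \<Otimes>\<^sub>M samples {1..<?s} \<Otimes>\<^sub>M U) (fresh_law ?s) ?g = fresh_law ?s" ..
  qed (intro prob_past prob_fresh prob_space_pair prob_samples prob_D prob_U)+
  also have "(\<lambda>(x, y). (restrict x {..<t}, (\<lambda>(x, y). (restrict x (sample_index T t), restrict y {..<t})) y)) = past T t"
    by (auto simp: past_def)
  also have "(\<lambda>\<omega>. ?g ((\<lambda>(x, y). (x t, (\<lambda>(x, y). (?h x, y t)) y)) \<omega>)) = fresh T t"
    using t by (auto simp: fresh_def fun_eq_iff)
  finally show ?thesis .
qed

lemma period_integral:
  assumes t: "t < T"
    and \<phi>: "(\<lambda>(c, z). \<phi> c z) \<in> borel_measurable (restrict_space borel capacities \<Otimes>\<^sub>M fresh_law (T - t))"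
    and G: "integrable (fresh_law (T - t)) G"
    and le: "\<And>c z. c \<in> capacities \<Longrightarrow> (\<And>k. c $ k \<le> b $ k) \<Longrightarrow> z \<in> space (fresh_law (T - t)) \<Longrightarrow> \<bar>\<phi> c z\<bar> \<le> G z"
  shows "integrable (past_law T T) (\<lambda>\<omega>. \<phi> (cap T t \<omega>) (fresh T t \<omega>) :: real)"
    and "integrable (past_law T T) (\<lambda>\<omega>. \<integral>z. \<phi> (cap T t \<omega>) z \<partial>fresh_law (T - t))"
    and "(\<integral>\<omega>. \<phi> (cap T t \<omega>) (fresh T t \<omega>) \<partial>past_law T T) =
      (\<integral>\<omega>. (\<integral>z. \<phi> (cap T t \<omega>) z \<partial>fresh_law (T - t)) \<partial>past_law T T)"
proof -
  have "(\<lambda>w. (cap T t (fst w), snd w)) \<in>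
      past_law T t \<Otimes>\<^sub>M fresh_law (T - t) \<rightarrow>\<^sub>M restrict_space borel capacities \<Otimes>\<^sub>M fresh_law (T - t)"
    using t by (intro measurable_Pair measurable_compose[OF measurable_fst cap_measurable(1)] measurable_snd) auto
  from measurable_compose[OF this \<phi>]
  have meas: "(\<lambda>(h, z). \<phi> (cap T t h) z) \<in> borel_measurable (past_law T t \<Otimes>\<^sub>M fresh_law (T - t))"
    by (simp add: split_beta')
  have bound: "\<bar>\<phi> (cap T t h) z\<bar> \<le> G z" if "h \<in> space (past_law T t)" "z \<in> space (fresh_law (T - t))" for h z
    using t that by (intro le cap_capacities cap_measurable(2)) auto
  note I = splits_integral[OF splits_period[OF t] prob_past prob_fresh meas G bound, unfolded cap_past]
  show "integrable (past_law T T) (\<lambda>\<omega>. \<phi> (cap T t \<omega>) (fresh T t \<omega>))"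
    "integrable (past_law T T) (\<lambda>\<omega>. \<integral>z. \<phi> (cap T t \<omega>) z \<partial>fresh_law (T - t))"
    "(\<integral>\<omega>. \<phi> (cap T t \<omega>) (fresh T t \<omega>) \<partial>past_law T T) =
      (\<integral>\<omega>. (\<integral>z. \<phi> (cap T t \<omega>) z \<partial>fresh_law (T - t)) \<partial>past_law T T)"
    by (rule I; assumption)+
qed

lemma cap_component_measurable:
  assumes "t \<le> T"
  shows "(\<lambda>\<omega>. cap T t \<omega> $ k) \<in> borel_measurable (past_law T T)"
  by (rule measurable_compose[OF cap_measurable(1) capacity_component_measurable]) (use assms in auto)

lemma cap_bounds:
  assumes "t \<le> T" "\<omega> \<in> space (past_law T T)"
  shows "0 \<le> cap T t \<omega> $ k" "cap T t \<omega> $ k \<le> b $ k"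
  using cap_capacities[OF assms(1) order_refl assms(2)] cap_measurable(2)[OF assms(1) order_refl assms(2)]
  by (auto simp: capacities_def)

lemma cap_integrable:
  assumes "t \<le> T"
  shows "integrable (past_law T T) (\<lambda>\<omega>. cap T t \<omega> $ k)"
proof -
  interpret prob_space "past_law T T" by (rule prob_past)
  show ?thesis
    using cap_bounds[OF assms]
    by (intro integrable_const_bound[where B="b $ k"] cap_component_measurable assms AE_I2) auto
qed

lemma period_use_measurable:
  assumes "0 < s"
  shows "(\<lambda>(c, z). period_use s c z $ k) \<in> borel_measurable (restrict_space borel capacities \<Otimes>\<^sub>M fresh_law s)"
  unfolding period_use_def by (rule payoff_measurable[OF consumption_measurable assms])

lemma period_use_measurable_fixed:
  assumes "0 < s" "c \<in> capacities"
  shows "(\<lambda>z. period_use s c z $ k) \<in> borel_measurable (fresh_law s)"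
  unfolding period_use_def by (rule payoff_measurable_fixed[OF consumption_measurable assms])

lemma cap_Suc_component:
  assumes "t < T" "\<omega> \<in> space (past_law T T)"
  shows "cap T (Suc t) \<omega> $ k = cap T t \<omega> $ k - period_use (T - t) (cap T t \<omega>) (fresh T t \<omega>) $ k"
proof -
  have "cap T t \<omega> \<in> capacities" "fresh T t \<omega> \<in> space (fresh_law (T - t))"
    using assms by (auto intro: cap_capacities[where t'=T] measurable_space[OF fresh_measurable[where t'=T]])
  from cap_Suc[OF assms(1) this] show ?thesis by simp
qed

definition mean_cap :: "nat \<Rightarrow> 'd \<Rightarrow> nat \<Rightarrow> real" where
  "mean_cap T k t = (\<integral>\<omega>. cap T t \<omega> $ k \<partial>past_law T T)"

text \<open>
Second moment of the amount by which the remaining capacity per remaining period falls short of its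
initial value \<open>b $ k / T\<close>.
\<close>

definition shortfall :: "nat \<Rightarrow> 'd \<Rightarrow> nat \<Rightarrow> real" where
  "shortfall T k t = (\<integral>\<omega>. (max 0 (b $ k / real T - cap T t \<omega> $ k / real (T - t)))\<^sup>2 \<partial>past_law T T)"

lemma b_nonneg: "0 \<le> b $ k"
  using b by (simp add: capacities_def)

lemma positive_part_square_le: "0 \<le> \<beta> \<Longrightarrow> 0 \<le> y \<Longrightarrow> (max 0 (\<beta> - y))\<^sup>2 \<le> (\<beta>::real)\<^sup>2"
  by (intro power_mono) auto

lemma shortfall_integrable:
  assumes "t \<le> T"
  shows "integrable (past_law T T) (\<lambda>\<omega>. (max 0 (b $ k / real T - cap T t \<omega> $ k / real (T - t)))\<^sup>2)"
proof -
  interpret prob_space "past_law T T" by (rule prob_past)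
  note [measurable] = cap_component_measurable[OF assms, of k]
  show ?thesis
  proof (rule integrable_const_bound[where B="(b $ k / real T)\<^sup>2"])
    show "AE \<omega> in past_law T T. norm ((max 0 (b $ k / real T - cap T t \<omega> $ k / real (T - t)))\<^sup>2) \<le> (b $ k / real T)\<^sup>2"
    proof (rule AE_I2)
      fix \<omega> assume "\<omega> \<in> space (past_law T T)"
      then show "norm ((max 0 (b $ k / real T - cap T t \<omega> $ k / real (T - t)))\<^sup>2) \<le> (b $ k / real T)\<^sup>2"
        using positive_part_square_le[of "b $ k / real T" "cap T t \<omega> $ k / real (T - t)"]
          cap_bounds[OF assms, of \<omega> k] b_nonneg[of k] by simp
    qed
  qed measurable
qed

lemma use_integral:
  assumes t: "t < T"
  shows "integrable (past_law T T) (\<lambda>\<omega>. \<integral>z. period_use (T - t) (cap T t \<omega>) z $ k \<partial>fresh_law (T - t))"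
    and "(\<integral>\<omega>. (\<integral>z. period_use (T - t) (cap T t \<omega>) z $ k \<partial>fresh_law (T - t)) \<partial>past_law T T) =
      mean_cap T k t - mean_cap T k (Suc t)"
proof -
  interpret F: prob_space "fresh_law (T - t)" by (rule prob_fresh)
  let ?X = "\<lambda>c z. period_use (T - t) c z $ k"
  have s: "0 < T - t" using t by simp
  have le: "\<bar>?X c z\<bar> \<le> b $ k" if "c \<in> capacities" "\<And>k. c $ k \<le> b $ k" "z \<in> space (fresh_law (T - t))" for c z
    using use_le_capacity[OF s that(1,3), of k] that(2)[of k] by (simp add: period_use_def)
  note I = period_integral[OF t period_use_measurable[OF s] F.integrable_const[of "b $ k"], of k]
  show "integrable (past_law T T) (\<lambda>\<omega>. \<integral>z. ?X (cap T t \<omega>) z \<partial>fresh_law (T - t))"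
    by (rule I(2)) (rule le)
  have "mean_cap T k (Suc t) = (\<integral>\<omega>. cap T t \<omega> $ k - ?X (cap T t \<omega>) (fresh T t \<omega>) \<partial>past_law T T)"
    unfolding mean_cap_def by (intro Bochner_Integration.integral_cong refl cap_Suc_component t)
  also have "\<dots> = mean_cap T k t - (\<integral>\<omega>. ?X (cap T t \<omega>) (fresh T t \<omega>) \<partial>past_law T T)"
    unfolding mean_cap_def
    by (rule Bochner_Integration.integral_diff[OF cap_integrable I(1)]) (use t le in auto)
  also have "(\<integral>\<omega>. ?X (cap T t \<omega>) (fresh T t \<omega>) \<partial>past_law T T) =
      (\<integral>\<omega>. (\<integral>z. ?X (cap T t \<omega>) z \<partial>fresh_law (T - t)) \<partial>past_law T T)"
    by (rule I(3)) (rule le)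
  finally show "(\<integral>\<omega>. (\<integral>z. ?X (cap T t \<omega>) z \<partial>fresh_law (T - t)) \<partial>past_law T T) =
      mean_cap T k t - mean_cap T k (Suc t)" by simp
qed

lemma shortfall_Suc:
  assumes t: "Suc t < T"
  shows "shortfall T k (Suc t) \<le> shortfall T k t +
    b $ k / N * (mean_cap T k t - mean_cap T k (Suc t)) / (real (T - Suc t))\<^sup>2"
proof -
  interpret F: prob_space "fresh_law (T - t)" by (rule prob_fresh)
  interpret P: prob_space "past_law T T" by (rule prob_past)
  have t': "t < T" and s: "0 < T - t" using t by auto
  let ?X = "\<lambda>c z. period_use (T - t) c z $ k"
  let ?\<beta> = "b $ k / real T"
  let ?s = "real (T - t)"
  have s1: "real (T - Suc t) = ?s - 1" "1 < ?s" using t by auto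
  define \<phi> where "\<phi> c z = (max 0 (?\<beta> - (c $ k - ?X c z) / (?s - 1)))\<^sup>2" for c z
  have meas: "(\<lambda>(c, z). \<phi> c z) \<in> borel_measurable (restrict_space borel capacities \<Otimes>\<^sub>M fresh_law (T - t))"
  proof -
    have 1: "(\<lambda>w. ?X (fst w) (snd w)) \<in> borel_measurable (restrict_space borel capacities \<Otimes>\<^sub>M fresh_law (T - t))"
      using period_use_measurable[OF s, of k] by (simp add: split_beta')
    have 2: "(\<lambda>w. fst w $ k) \<in> borel_measurable (restrict_space borel capacities \<Otimes>\<^sub>M fresh_law (T - t))"
      by (rule measurable_compose[OF measurable_fst capacity_component_measurable])
    show ?thesis
      unfolding \<phi>_def split_beta'
      by (intro borel_measurable_power borel_measurable_max borel_measurable_diff borel_measurable_divide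
          borel_measurable_const 1 2)
  qed
  have le: "\<bar>\<phi> c z\<bar> \<le> ?\<beta>\<^sup>2" if "c \<in> capacities" "z \<in> space (fresh_law (T - t))" for c z
    using positive_part_square_le[of ?\<beta> "(c $ k - ?X c z) / (?s - 1)"] b_nonneg[of k] s1(2)
      use_le_capacity(1)[OF s that, of k] by (simp add: \<phi>_def period_use_def)
  note I = period_integral[OF t' meas F.integrable_const[of "?\<beta>\<^sup>2"]]
  have step: "(\<integral>z. \<phi> c z \<partial>fresh_law (T - t)) \<le> (max 0 (?\<beta> - c $ k / ?s))\<^sup>2 +
      b $ k / N * (\<integral>z. ?X c z \<partial>fresh_law (T - t)) / (?s - 1)\<^sup>2" if c: "c \<in> capacities" for c
    unfolding \<phi>_def
  proof (rule F.shortfall_step)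
    show "(\<lambda>z. ?X c z) \<in> borel_measurable (fresh_law (T - t))"
      by (rule period_use_measurable_fixed[OF s c])
    show "AE z in fresh_law (T - t). 0 \<le> ?X c z"
      unfolding period_use_def by (intro AE_I2 use_le_capacity(2)[OF s c])
    show "AE z in fresh_law (T - t). N * ?X c z \<le> b $ k"
      unfolding period_use_def by (rule use_small[OF s c])
    show "F.expectation (\<lambda>z. ?X c z) \<le> c $ k / ?s"
      unfolding period_use_def by (rule expected_use[OF s c])
  qed (use N_pos s1 in auto)
  have "shortfall T k (Suc t) = (\<integral>\<omega>. \<phi> (cap T t \<omega>) (fresh T t \<omega>) \<partial>past_law T T)"
    unfolding shortfall_def \<phi>_def s1(1)
    by (intro Bochner_Integration.integral_cong refl) (simp only: cap_Suc_component[OF t'])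
  also have "\<dots> = (\<integral>\<omega>. (\<integral>z. \<phi> (cap T t \<omega>) z \<partial>fresh_law (T - t)) \<partial>past_law T T)"
    by (rule I(3)) (rule le)
  also have "\<dots> \<le> (\<integral>\<omega>. (max 0 (?\<beta> - cap T t \<omega> $ k / ?s))\<^sup>2 +
      b $ k / N * (\<integral>z. ?X (cap T t \<omega>) z \<partial>fresh_law (T - t)) / (?s - 1)\<^sup>2 \<partial>past_law T T)"
  proof (rule Bochner_Integration.integral_mono)
    show "integrable (past_law T T) (\<lambda>\<omega>. \<integral>z. \<phi> (cap T t \<omega>) z \<partial>fresh_law (T - t))"
      by (rule I(2)) (rule le)
    show "integrable (past_law T T) (\<lambda>\<omega>. (max 0 (?\<beta> - cap T t \<omega> $ k / ?s))\<^sup>2 +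
        b $ k / N * (\<integral>z. ?X (cap T t \<omega>) z \<partial>fresh_law (T - t)) / (?s - 1)\<^sup>2)"
      using t' by (intro Bochner_Integration.integrable_add shortfall_integrable integrable_divide
          integrable_mult_right use_integral(1)) auto
    show "(\<integral>z. \<phi> (cap T t \<omega>) z \<partial>fresh_law (T - t)) \<le> (max 0 (?\<beta> - cap T t \<omega> $ k / ?s))\<^sup>2 +
        b $ k / N * (\<integral>z. ?X (cap T t \<omega>) z \<partial>fresh_law (T - t)) / (?s - 1)\<^sup>2"
      if "\<omega> \<in> space (past_law T T)" for \<omega>
      using t' that by (intro step cap_capacities[where t'=T]) auto
  qed
  also have "\<dots> = shortfall T k t + b $ k / N * (mean_cap T k t - mean_cap T k (Suc t)) / (?s - 1)\<^sup>2"
  proof (subst Bochner_Integration.integral_add)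
    show "integrable (past_law T T) (\<lambda>\<omega>. (max 0 (?\<beta> - cap T t \<omega> $ k / ?s))\<^sup>2)"
      using t' by (intro shortfall_integrable) auto
    show "integrable (past_law T T) (\<lambda>\<omega>. b $ k / N * (\<integral>z. ?X (cap T t \<omega>) z \<partial>fresh_law (T - t)) / (?s - 1)\<^sup>2)"
      by (intro integrable_divide integrable_mult_right use_integral(1)[OF t'])
  qed (simp add: shortfall_def use_integral(2)[OF t'])
  finally show ?thesis unfolding s1(1) .
qed

lemma mean_cap_le: "t \<le> T \<Longrightarrow> mean_cap T k t \<le> b $ k"
proof -
  assume t: "t \<le> T"
  interpret P: prob_space "past_law T T" by (rule prob_past)
  have "mean_cap T k t \<le> (\<integral>\<omega>. b $ k \<partial>past_law T T)"
    unfolding mean_cap_def by (intro Bochner_Integration.integral_mono cap_integrable[OF t] cap_bounds[OF t]) auto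
  then show ?thesis by (simp add: P.prob_space)
qed

lemma mean_cap_nonneg: "t \<le> T \<Longrightarrow> 0 \<le> mean_cap T k t"
  unfolding mean_cap_def by (intro integral_nonneg_AE AE_I2 cap_bounds)

text \<open>
The increments in \<open>shortfall_Suc\<close> are proportional to the expected use in the period. The last
denominator is the smallest, so it may replace all the earlier ones, and the uses then telescope to
the total expected use \<open>b $ k - mean_cap T k t\<close>.
\<close>

lemma shortfall_le:
  assumes "t < T"
  shows "shortfall T k t \<le> b $ k / N * (b $ k - mean_cap T k t) / (real (T - t))\<^sup>2"
  using assms
proof (induction t)
  case 0
  interpret P: prob_space "past_law T T" by (rule prob_past)
  show ?case by (simp add: shortfall_def mean_cap_def cap_0 P.prob_space)
next
  case (Suc t)
  let ?e = "mean_cap T k"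
  have "shortfall T k (Suc t) \<le> shortfall T k t + b $ k / N * (?e t - ?e (Suc t)) / (real (T - Suc t))\<^sup>2"
    by (rule shortfall_Suc[OF Suc.prems])
  also have "shortfall T k t \<le> b $ k / N * (b $ k - ?e t) / (real (T - t))\<^sup>2"
    using Suc by simp
  also have "\<dots> \<le> b $ k / N * (b $ k - ?e t) / (real (T - Suc t))\<^sup>2"
    using Suc.prems b_nonneg[of k] N_pos mean_cap_le[of t T k]
    by (intro divide_left_mono power_mono mult_nonneg_nonneg) auto
  also have "b $ k / N * (b $ k - ?e t) / (real (T - Suc t))\<^sup>2 +
      b $ k / N * (?e t - ?e (Suc t)) / (real (T - Suc t))\<^sup>2 =
      b $ k / N * (b $ k - ?e (Suc t)) / (real (T - Suc t))\<^sup>2"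
    by (simp add: add_divide_distrib[symmetric] distrib_left[symmetric])
  finally show ?case by simp
qed

text \<open>
Markov's inequality for the squared shortfall: low capacity means a shortfall of at least
\<open>\<delta> * b $ k / T\<close>.
\<close>

lemma prob_low_capacity:
  assumes t: "t < T" and d: "0 < \<delta>" and late: "\<delta> * real T \<le> real (T - t)"
  shows "measure (past_law T T) {\<omega> \<in> space (past_law T T).
      cap T t \<omega> $ k < (1 - \<delta>) * (real (T - t) / real T) * b $ k} \<le> 1 / (N * \<delta> ^ 4)"
    (is "measure _ ?bad \<le> _")
proof (cases "b $ k = 0")
  case True
  then have bad: "?bad = {}" using cap_bounds(1)[of t T _ k] t by (auto simp: not_less)
  show ?thesis unfolding bad using N_pos d by simp
next
  case False
  interpret P: prob_space "past_law T T" by (rule prob_past)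
  have bk: "0 < b $ k" using False b_nonneg[of k] by simp
  have T: "0 < real T" and s: "0 < real (T - t)" using t by auto
  let ?\<beta> = "b $ k / real T"
  have meas: "?bad \<in> sets (past_law T T)"
    using cap_component_measurable[of t T k] t by (intro borel_measurable_less) auto
  have "(\<delta> * ?\<beta>)\<^sup>2 * measure (past_law T T) ?bad = (\<integral>\<omega>. (\<delta> * ?\<beta>)\<^sup>2 * indicator ?bad \<omega> \<partial>past_law T T)"
    using meas by simp
  also have "\<dots> \<le> shortfall T k t"
    unfolding shortfall_def
  proof (rule Bochner_Integration.integral_mono)
    show "integrable (past_law T T) (\<lambda>\<omega>. (\<delta> * ?\<beta>)\<^sup>2 * indicator ?bad \<omega>)"
      by (rule integrable_real_mult_indicator[OF meas P.integrable_const])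
    show "integrable (past_law T T) (\<lambda>\<omega>. (max 0 (?\<beta> - cap T t \<omega> $ k / real (T - t)))\<^sup>2)"
      using t by (intro shortfall_integrable) auto
    show "(\<delta> * ?\<beta>)\<^sup>2 * indicator ?bad \<omega> \<le> (max 0 (?\<beta> - cap T t \<omega> $ k / real (T - t)))\<^sup>2" for \<omega>
    proof (cases "\<omega> \<in> ?bad")
      case True
      then have "cap T t \<omega> $ k / real (T - t) \<le> (1 - \<delta>) * ?\<beta>"
        using s by (simp add: field_simps)
      moreover have "\<delta> * y \<le> y - x" if "x \<le> (1 - \<delta>) * y" for x y :: real
        using that by (simp add: algebra_simps)
      ultimately have "\<delta> * ?\<beta> \<le> max 0 (?\<beta> - cap T t \<omega> $ k / real (T - t))"
        by (intro max.coboundedI2)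
      then show ?thesis using True d bk T by (auto intro!: power_mono)
    qed simp
  qed
  also have "\<dots> \<le> b $ k / N * (b $ k - mean_cap T k t) / (real (T - t))\<^sup>2"
    by (rule shortfall_le[OF t])
  also have "\<dots> \<le> b $ k / N * b $ k / (\<delta> * real T)\<^sup>2"
    using bk N_pos d T s late mean_cap_nonneg[of t T k] mean_cap_le[of t T k] t
    by (intro frac_le mult_left_mono power_mono mult_nonneg_nonneg) auto
  finally have "(\<delta> * ?\<beta>)\<^sup>2 * measure (past_law T T) ?bad \<le> (\<delta> * ?\<beta>)\<^sup>2 * (1 / (N * \<delta> ^ 4))"
    using bk N_pos d T by (simp add: power_mult_distrib power_divide field_simps power2_eq_square eval_nat_numeral)
  then show ?thesis
    using bk d T by (subst (asm) mult_le_cancel_left_pos) auto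
qed

section \<open>The performance guarantee\<close>

definition gain :: "nat \<Rightarrow> nat \<Rightarrow> ('d, 'u) scenario \<Rightarrow> real" where
  "gain T t \<omega> = reward m (fst (fresh T t \<omega>) 0) (solution (T - t) (cap T t \<omega>) (fresh T t \<omega>) ! 0)"

lemma gain_integral:
  assumes t: "t < T"
  shows "integrable (past_law T T) (gain T t)"
    and "integrable (past_law T T) (\<lambda>\<omega>. V (T - t) (cap T t \<omega>) / real (T - t))"
    and "(\<integral>\<omega>. gain T t \<omega> \<partial>past_law T T) = (\<integral>\<omega>. V (T - t) (cap T t \<omega>) / real (T - t) \<partial>past_law T T)"
proof -
  have s: "0 < T - t" using t by simp
  let ?\<phi> = "\<lambda>c z. reward m (fst z 0) (solution (T - t) c z ! 0)"
  have le: "\<bar>?\<phi> c z\<bar> \<le> reward_size (fst z 0)"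
    if "c \<in> capacities" "\<And>k. c $ k \<le> b $ k" "z \<in> space (fresh_law (T - t))" for c z
    by (rule reward_le_size[OF solution_feasible(2)[OF that(1,3) s]])
  note I = period_integral[OF t payoff_measurable[OF reward_measurable s]
      integrable_fresh_component[OF integrable_reward_size s] le]
  have V: "(\<integral>z. ?\<phi> (cap T t \<omega>) z \<partial>fresh_law (T - t)) = V (T - t) (cap T t \<omega>) / real (T - t)"
    if "\<omega> \<in> space (past_law T T)" for \<omega>
    using t that by (intro expected_gain s cap_capacities[where t'=T]) auto
  show "integrable (past_law T T) (gain T t)"
    unfolding gain_def by (rule I(1); assumption)
  show "integrable (past_law T T) (\<lambda>\<omega>. V (T - t) (cap T t \<omega>) / real (T - t))"
    by (rule Bochner_Integration.integrable_cong[OF refl V, THEN iffD1, OF _ I(2)]; assumption)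
  have "(\<integral>\<omega>. gain T t \<omega> \<partial>past_law T T) =
      (\<integral>\<omega>. (\<integral>z. ?\<phi> (cap T t \<omega>) z \<partial>fresh_law (T - t)) \<partial>past_law T T)"
    unfolding gain_def by (rule I(3); assumption)
  also have "\<dots> = (\<integral>\<omega>. V (T - t) (cap T t \<omega>) / real (T - t) \<partial>past_law T T)"
    by (intro Bochner_Integration.integral_cong refl V)
  finally show "(\<integral>\<omega>. gain T t \<omega> \<partial>past_law T T) = (\<integral>\<omega>. V (T - t) (cap T t \<omega>) / real (T - t) \<partial>past_law T T)" .
qed

lemma gain_nonneg:
  assumes "t < T"
  shows "0 \<le> (\<integral>\<omega>. gain T t \<omega> \<partial>past_law T T)"
  unfolding gain_integral(3)[OF assms] using assms
  by (intro integral_nonneg_AE AE_I2 divide_nonneg_nonneg V_nonneg cap_capacities[where t'=T]) auto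

lemma expected_OSO_eq: "expected_OSO U sol m b D T = (\<Sum>t<T. \<integral>\<omega>. gain T t \<omega> \<partial>past_law T T)"
proof -
  have law: "(\<Pi>\<^sub>M t\<in>{..<T}. D) \<Otimes>\<^sub>M (\<Pi>\<^sub>M p\<in>{(t, \<tau>). t < \<tau> \<and> \<tau> < T}. D) \<Otimes>\<^sub>M (\<Pi>\<^sub>M t\<in>{..<T}. U) = past_law T T"
  proof -
    have "{(t, \<tau>). t < \<tau> \<and> \<tau> < T} = sample_index T T" by (auto simp: sample_index_def)
    then show ?thesis by (simp add: past_law_def)
  qed
  have "expected_OSO U sol m b D T = (\<integral>\<omega>. (\<Sum>t<T. gain T t \<omega>) \<partial>past_law T T)"
    unfolding expected_OSO_def law
  proof (intro Bochner_Integration.integral_cong refl)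
    fix \<omega> assume \<omega>: "\<omega> \<in> space (past_law T T)"
    obtain \<xi> \<zeta> u where eq: "\<omega> = (\<xi>, \<zeta>, u)" by (cases \<omega>) auto
    have "reward m (\<xi> t) (oso sol m b T \<xi> \<zeta> u T ! t) = gain T t \<omega>" if t: "t < T" for t
    proof -
      have "oso sol m b T \<xi> \<zeta> u T ! t = solution (T - t) (cap T t \<omega>) (fresh T t \<omega>) ! 0"
        unfolding oso_nth_stable[OF t] eq using t \<omega>
        by (intro oso_step cap_capacities[where t'=T] measurable_space[OF fresh_measurable[where t'=T]])
          (auto simp: eq)
      then show ?thesis using t by (simp add: gain_def eq fresh_def)
    qed
    then show "(case \<omega> of (\<xi>, \<zeta>, u) \<Rightarrow> total_reward m (map \<xi> [0..<T]) (oso sol m b T \<xi> \<zeta> u T)) =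
        (\<Sum>t<T. gain T t \<omega>)"
      by (simp add: eq total_reward_def)
  qed
  also have "\<dots> = (\<Sum>t<T. \<integral>\<omega>. gain T t \<omega> \<partial>past_law T T)"
    by (intro Bochner_Integration.integral_sum gain_integral(1)) auto
  finally show ?thesis .
qed

lemma expected_OPT_eq: "expected_OPT m b D T = V T b"
  by (simp add: expected_OPT_def V_def)

text \<open>
On the event that no resource is low, \<open>V_thin\<close> applies with \<open>q = (1 - 2\<delta>)(T - t)/T\<close> and
\<open>\<theta> = \<delta>(T - t)/T \<ge> \<delta>\<^sup>2\<close>; on its complement the value is merely nonnegative. The exceptional event
and the overflow in thinning each cost a factor of no less than \<open>1 - (d + 1)/(N\<delta>\<^sup>4)\<close>.
\<close>

lemma gain_lower_bound:
  assumes t: "t < T" and d: "0 < \<delta>" "\<delta> \<le> 1 / 2" and late: "\<delta> * real T \<le> real (T - t)"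
    and NT: "N \<le> real T" and small: "(real CARD('d) + 1) / (N * \<delta> ^ 4) \<le> 1"
  shows "(1 - 2 * \<delta> - 2 * (real CARD('d) + 1) / (N * \<delta> ^ 4)) * V T b / real T
    \<le> (\<integral>\<omega>. gain T t \<omega> \<partial>past_law T T)"
proof -
  interpret P: prob_space "past_law T T" by (rule prob_past)
  define \<kappa> where "\<kappa> = (real CARD('d) + 1) / (N * \<delta> ^ 4)"
  let ?s = "real (T - t)"
  define bad where "bad k = {\<omega> \<in> space (past_law T T). cap T t \<omega> $ k < (1 - \<delta>) * (?s / real T) * b $ k}" for k
  let ?good = "space (past_law T T) - (\<Union>k. bad k)"
  have \<kappa>: "0 \<le> \<kappa>" "\<kappa> \<le> 1" using N_pos d small by (auto simp: \<kappa>_def)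
  have T: "0 < real T" and s: "0 < ?s" and sT: "?s \<le> real T" using t by auto
  have "bad k \<in> sets (past_law T T)" for k
    unfolding bad_def using cap_component_measurable[of t T k] t by (intro borel_measurable_less) auto
  then have bads: "range bad \<subseteq> sets (past_law T T)" "(\<Union>k. bad k) \<in> sets (past_law T T)"
    by (auto intro!: sets.finite_UN)
  then have good: "?good \<in> sets (past_law T T)" by (intro sets.compl_sets)
  have "measure (past_law T T) (\<Union>k. bad k) \<le> (\<Sum>k\<in>UNIV. measure (past_law T T) (bad k))"
    by (rule P.finite_measure_subadditive_finite[OF finite bads(1)])
  also have "\<dots> \<le> (\<Sum>k\<in>(UNIV::'d set). 1 / (N * \<delta> ^ 4))"
    unfolding bad_def by (intro sum_mono prob_low_capacity t d late)
  also have "\<dots> \<le> \<kappa>" using N_pos d by (simp add: \<kappa>_def divide_right_mono)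
  finally have prob_good: "1 - \<kappa> \<le> measure (past_law T T) ?good"
    unfolding P.prob_compl[OF bads(2)] by simp
  define v where "v = (1 - 2 * \<delta>) * (1 - \<kappa>) * V T b / real T"
  have V0: "0 \<le> V T b" by (rule V_nonneg[OF b])
  have v0: "0 \<le> v" unfolding v_def using d \<kappa> V0 by (intro divide_nonneg_nonneg mult_nonneg_nonneg) auto
  have v_le: "v \<le> V (T - t) (cap T t \<omega>) / ?s" if \<omega>: "\<omega> \<in> ?good" for \<omega>
  proof -
    define q where "q = (1 - 2 * \<delta>) * (?s / real T)"
    define \<theta> where "\<theta> = \<delta> * (?s / real T)"
    have q\<theta>: "q + \<theta> = (1 - \<delta>) * (?s / real T)"
    proof -
      have "(1 - 2 * \<delta>) * r + \<delta> * r = (1 - \<delta>) * r" for r by (simp add: algebra_simps)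
      then show ?thesis by (simp only: q_def \<theta>_def)
    qed
    have ratio: "\<delta> \<le> ?s / real T" "?s / real T \<le> 1" using late T sT by (simp_all add: field_simps)
    have \<theta>: "\<delta>\<^sup>2 \<le> \<theta>"
      unfolding \<theta>_def power2_eq_square using d by (intro mult_left_mono[OF ratio(1)]) simp
    have \<theta>_pos: "0 < \<theta>" unfolding \<theta>_def by (intro mult_pos_pos divide_pos_pos d s T)
    have thin: "q * (1 - (real CARD('d) + 1) / (N * \<theta>\<^sup>2)) * V T b \<le> V (T - t) (cap T t \<omega>)"
    proof (rule V_thin)
      show "cap T t \<omega> \<in> capacities" using \<omega> t by (intro cap_capacities[where t'=T]) auto
      show "0 \<le> q" unfolding q_def using d T by simp
      show "q \<le> 1" unfolding q_def using d ratio s T by (intro mult_le_one) auto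
      show "(q + \<theta>) * b $ k \<le> cap T t \<omega> $ k" for k
        using \<omega> unfolding q\<theta> by (auto simp: bad_def not_less)
      show "(q + \<theta>) * real T \<le> real (T - t)"
        unfolding q\<theta> using T s d by (simp add: mult_le_cancel_right1)
    qed (rule NT, rule \<theta>_pos)
    have "\<delta> ^ 4 \<le> \<theta>\<^sup>2"
    proof -
      have "\<delta> ^ 4 = (\<delta>\<^sup>2)\<^sup>2" by (simp flip: power_mult)
      also have "\<dots> \<le> \<theta>\<^sup>2" using \<theta> by (intro power_mono) auto
      finally show ?thesis .
    qed
    then have "(real CARD('d) + 1) / (N * \<theta>\<^sup>2) \<le> \<kappa>"
      unfolding \<kappa>_def using N_pos d \<theta>_pos by (intro divide_left_mono mult_left_mono mult_pos_pos) auto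
    then have "q * (1 - \<kappa>) * V T b \<le> q * (1 - (real CARD('d) + 1) / (N * \<theta>\<^sup>2)) * V T b"
      using d T V0 by (intro mult_right_mono mult_left_mono) (auto simp: q_def)
    with thin have "q * (1 - \<kappa>) * V T b \<le> V (T - t) (cap T t \<omega>)" by (rule order_trans[rotated])
    moreover have "q * (1 - \<kappa>) * V T b = v * ?s" by (simp add: q_def v_def)
    ultimately show ?thesis using s by (simp add: field_simps)
  qed
  have "(1 - 2 * \<delta> - 2 * (real CARD('d) + 1) / (N * \<delta> ^ 4)) = 1 - 2 * \<delta> - 2 * \<kappa>"
    by (simp add: \<kappa>_def)
  also have "1 - 2 * \<delta> - 2 * \<kappa> \<le> (1 - \<kappa>) * ((1 - 2 * \<delta>) * (1 - \<kappa>))"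
  proof -
    have "(1 - \<kappa>) * ((1 - 2 * \<delta>) * (1 - \<kappa>)) - (1 - 2 * \<delta> - 2 * \<kappa>) = \<kappa>\<^sup>2 * (1 - 2 * \<delta>) + 4 * \<delta> * \<kappa>"
      by (simp add: power2_eq_square algebra_simps)
    moreover have "0 \<le> \<kappa>\<^sup>2 * (1 - 2 * \<delta>) + 4 * \<delta> * \<kappa>" using \<kappa> d by (intro add_nonneg_nonneg mult_nonneg_nonneg) auto
    ultimately show ?thesis by linarith
  qed
  finally have "(1 - 2 * \<delta> - 2 * (real CARD('d) + 1) / (N * \<delta> ^ 4)) * V T b / real T \<le>
      (1 - \<kappa>) * ((1 - 2 * \<delta>) * (1 - \<kappa>)) * V T b / real T"
    using V0 T by (intro divide_right_mono mult_right_mono) auto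
  also have "\<dots> = (1 - \<kappa>) * v" by (simp add: v_def)
  also have "\<dots> \<le> measure (past_law T T) ?good * v"
    using prob_good v0 by (rule mult_right_mono)
  also have "\<dots> = (\<integral>\<omega>. v * indicator ?good \<omega> \<partial>past_law T T)"
    using good by simp
  also have "\<dots> \<le> (\<integral>\<omega>. V (T - t) (cap T t \<omega>) / ?s \<partial>past_law T T)"
  proof (rule Bochner_Integration.integral_mono)
    show "integrable (past_law T T) (\<lambda>\<omega>. v * indicator ?good \<omega>)"
      by (rule integrable_real_mult_indicator[OF good P.integrable_const])
    show "integrable (past_law T T) (\<lambda>\<omega>. V (T - t) (cap T t \<omega>) / ?s)" by (rule gain_integral(2)[OF t])
    fix \<omega> assume \<omega>: "\<omega> \<in> space (past_law T T)"
    have "0 \<le> V (T - t) (cap T t \<omega>) / ?s"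
      using t \<omega> by (intro divide_nonneg_nonneg V_nonneg cap_capacities[where t'=T]) auto
    then show "v * indicator ?good \<omega> \<le> V (T - t) (cap T t \<omega>) / ?s"
      using v_le[of \<omega>] by (cases "\<omega> \<in> ?good") auto
  qed
  also have "\<dots> = (\<integral>\<omega>. gain T t \<omega> \<partial>past_law T T)" by (rule gain_integral(3)[OF t, symmetric])
  finally show ?thesis .
qed

text \<open>
The last \<open>\<delta>T\<close> periods are given up, because the estimates degrade there; this costs one more \<open>\<delta>\<close>.
\<close>

lemma competitive_ratio:
  assumes T: "1 \<le> T" and NT: "N \<le> real T" and d: "0 < \<delta>"
    and small: "3 * \<delta> + 2 * (real CARD('d) + 1) / (N * \<delta> ^ 4) \<le> 1"
  shows "(1 - (3 * \<delta> + 2 * (real CARD('d) + 1) / (N * \<delta> ^ 4))) * expected_OPT m b D T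
    \<le> expected_OSO U sol m b D T"
proof -
  define \<kappa> where "\<kappa> = (real CARD('d) + 1) / (N * \<delta> ^ 4)"
  have \<kappa>0: "0 \<le> \<kappa>" unfolding \<kappa>_def using N_pos d by simp
  have small': "3 * \<delta> + 2 * \<kappa> \<le> 1" using small by (simp add: \<kappa>_def)
  have V0: "0 \<le> V T b" by (rule V_nonneg[OF b])
  define v where "v = (1 - 2 * \<delta> - 2 * \<kappa>) * V T b / real T"
  have v0: "0 \<le> v" unfolding v_def using small' d V0 by (intro divide_nonneg_nonneg mult_nonneg_nonneg) auto
  let ?L = "{t. t < T \<and> \<delta> * real T \<le> real (T - t)}"
  have "(1 - \<delta>) * real T \<le> real (card ?L)"
  proof -
    \<comment> \<open>Periods are numbered from \<open>0\<close>, so rounding up loses nothing.\<close>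
    have "{..<nat \<lceil>(1 - \<delta>) * real T\<rceil>} \<subseteq> ?L"
    proof
      fix t assume "t \<in> {..<nat \<lceil>(1 - \<delta>) * real T\<rceil>}"
      then have "real t < (1 - \<delta>) * real T" by (simp add: less_ceiling_iff zless_nat_eq_int_zless)
      moreover have "0 \<le> \<delta> * real T" using d by simp
      ultimately show "t \<in> ?L" by (auto simp: algebra_simps of_nat_diff)
    qed
    then have "card {..<nat \<lceil>(1 - \<delta>) * real T\<rceil>} \<le> card ?L" by (intro card_mono) auto
    then have "nat \<lceil>(1 - \<delta>) * real T\<rceil> \<le> card ?L" by simp
    then show ?thesis by linarith
  qed
  moreover have "(1 - (3 * \<delta> + 2 * \<kappa>)) * V T b \<le> (1 - \<delta>) * real T * v"
  proof -
    have "(1 - \<delta>) * (1 - 2 * \<delta> - 2 * \<kappa>) - (1 - (3 * \<delta> + 2 * \<kappa>)) = 2 * \<delta>\<^sup>2 + 2 * \<delta> * \<kappa>"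
      by (simp add: power2_eq_square algebra_simps)
    moreover have "0 \<le> 2 * \<delta>\<^sup>2 + 2 * \<delta> * \<kappa>" using \<kappa>0 d by simp
    ultimately have "1 - (3 * \<delta> + 2 * \<kappa>) \<le> (1 - \<delta>) * (1 - 2 * \<delta> - 2 * \<kappa>)" by linarith
    then have "(1 - (3 * \<delta> + 2 * \<kappa>)) * V T b \<le> (1 - \<delta>) * (1 - 2 * \<delta> - 2 * \<kappa>) * V T b"
      using V0 by (rule mult_right_mono)
    also have "\<dots> = (1 - \<delta>) * real T * v" using T by (simp add: v_def)
    finally show ?thesis .
  qed
  ultimately have "(1 - (3 * \<delta> + 2 * \<kappa>)) * V T b \<le> real (card ?L) * v"
    using v0 by (meson mult_right_mono order_trans)
  also have "\<dots> = (\<Sum>t\<in>?L. v)" by simp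
  also have "\<dots> \<le> (\<Sum>t\<in>?L. \<integral>\<omega>. gain T t \<omega> \<partial>past_law T T)"
  proof (rule sum_mono)
    fix t assume "t \<in> ?L"
    then have t: "t < T" "\<delta> * real T \<le> real (T - t)" by auto
    have "\<delta> \<le> 1 / 2" "(real CARD('d) + 1) / (N * \<delta> ^ 4) \<le> 1"
      using small' \<kappa>0 d unfolding \<kappa>_def[symmetric] by linarith+
    from gain_lower_bound[OF t(1) d this(1) t(2) NT this(2)]
    show "v \<le> (\<integral>\<omega>. gain T t \<omega> \<partial>past_law T T)"
      by (simp only: v_def \<kappa>_def times_divide_eq_right)
  qed
  also have "\<dots> \<le> (\<Sum>t<T. \<integral>\<omega>. gain T t \<omega> \<partial>past_law T T)"
    by (rule sum_mono2) (auto intro: gain_nonneg)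
  finally show ?thesis
    unfolding expected_OSO_eq expected_OPT_eq \<kappa>_def by simp
qed

end

section \<open>Growing capacities\<close>

text \<open>
The complement of the support is covered by open null sets, countably many of which suffice because
the item space is second countable.
\<close>

lemma AE_support:
  fixes D :: "('d::finite) item measure"
  assumes "prob_space D" and sets_D: "sets D = sets (item_space m)"
  shows "AE \<xi> in D. \<xi> \<in> support D"
proof -
  interpret prob_space D by fact
  have space_D: "space D = items m"
    using sets_eq_imp_space_eq[OF sets_D] by (simp add: item_space_def space_restrict_space)
  define F where "F = {V :: 'd item set. open V \<and> measure D (V \<inter> space D) = 0}"
  obtain F' where F': "F' \<subseteq> F" "countable F'" "\<Union>F' = \<Union>F"
    by (rule Lindelof[of F]) (auto simp: F_def)
  have "AE \<xi> in D. \<forall>V\<in>F'. \<xi> \<notin> V"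
  proof (rule AE_ball_countable[OF F'(2), THEN iffD2], rule ballI)
    fix V assume "V \<in> F'"
    then have V: "open V" "measure D (V \<inter> space D) = 0" using F'(1) by (auto simp: F_def)
    have "items m \<inter> V \<in> (\<inter>) (items m) ` sets borel"
      using V(1) by (intro imageI borel_open)
    then have "V \<inter> space D \<in> sets D"
      unfolding sets_D space_D item_space_def sets_restrict_space Int_commute[of V] .
    with V(2) have "V \<inter> space D \<in> null_sets D"
      by (simp add: null_sets_def emeasure_eq_measure)
    then show "AE \<xi> in D. \<xi> \<notin> V"
      by (rule AE_I') auto
  qed
  then show ?thesis
    using AE_space
  proof eventually_elim
    case (elim \<xi>)
    show ?case
    proof (rule ccontr)
      assume "\<xi> \<notin> support D"
      with elim(2) obtain V where V: "open V" "\<xi> \<in> V" "\<not> 0 < measure D (V \<inter> space D)"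
        by (auto simp: support_def)
      then have "V \<in> F" using measure_nonneg[of D "V \<inter> space D"] by (simp add: F_def)
      with V(2) F'(3) obtain V' where "V' \<in> F'" "\<xi> \<in> V'" by blast
      with elim(1) show False by blast
    qed
  qed
qed

text \<open>
The cases that need care are those where the quotient in the capacity scale is not the ordinary
one: a zero maximum means that nothing is consumed, and an infinite maximum would make the scale
zero.
\<close>

lemma small_of_capacity_scale:
  assumes inst: "allocation_instance m b D" and L: "0 < L" "ereal L \<le> capacity_scale m b D"
  shows "AE \<xi> in D. \<forall>j<m. \<forall>k. L * snd \<xi> j $ k \<le> b $ k"
proof -
  have prob: "prob_space D" and sets: "sets D = sets (item_space m)" and b: "\<And>k. 0 \<le> b $ k"
    using inst by (auto simp: allocation_instance_def)
  have space_D: "space D = items m"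
    using sets_eq_imp_space_eq[OF sets] by (simp add: item_space_def space_restrict_space)
  show ?thesis
    using AE_support[OF prob sets]
  proof eventually_elim
    case (elim \<xi>)
    show ?case
    proof (intro allI impI)
      fix j k assume j: "j < m"
      let ?M = "max_consumption m D k"
      let ?a = "snd \<xi> j $ k"
      have aM: "ereal ?a \<le> ?M"
        unfolding max_consumption_def using elim j by (intro SUP_upper2[OF elim] SUP_upper) auto
      have a0: "0 \<le> ?a"
        using elim j space_D by (auto simp: support_def items_def)
      show "L * ?a \<le> b $ k"
      proof (cases "?M = 0")
        case True
        with aM a0 have "?a = 0" by simp
        then show ?thesis using b by simp
      next
        case False
        have "capacity_scale m b D \<le> (if ?M = 0 then \<infinity> else ereal (b $ k) / ?M)"
          unfolding capacity_scale_def by (intro Min_le) auto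
        with L(2) False have LM: "ereal L \<le> ereal (b $ k) / ?M" by simp
        show ?thesis
        proof (cases ?M)
          case (real M)
          then have "0 < M" "?a \<le> M" using aM a0 False by auto
          moreover have "L \<le> b $ k / M" using LM real \<open>0 < M\<close> by simp
          then have "L * M \<le> b $ k" using \<open>0 < M\<close> by (simp add: field_simps)
          ultimately show ?thesis using L(1) mult_left_mono[of ?a M L] by linarith
        next
          case PInf
          then show ?thesis using LM L(1) by simp
        next
          case MInf
          then show ?thesis using aM by simp
        qed
      qed
    qed
  qed
qed

lemma filterlim_log_power:
  fixes c \<sigma> :: real
  assumes "0 < c" "0 < \<sigma>"
  shows "filterlim (\<lambda>T. min (c * ln (real T) powr (1 + \<sigma>)) (real T)) at_top sequentially"
proof -
  have "filterlim (\<lambda>T. ln (real T)) at_top sequentially"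
    by (rule filterlim_compose[OF ln_at_top filterlim_real_sequentially])
  then have ln: "eventually (\<lambda>T. z \<le> ln (real T)) sequentially" for z
    by (simp add: filterlim_at_top)
  have real: "eventually (\<lambda>T. z \<le> real T) sequentially" for z
    using filterlim_real_sequentially by (simp add: filterlim_at_top)
  show ?thesis
    unfolding filterlim_at_top
  proof
    fix z
    show "eventually (\<lambda>T. z \<le> min (c * ln (real T) powr (1 + \<sigma>)) (real T)) sequentially"
      using ln[of 1] ln[of "z / c"] real[of z]
    proof eventually_elim
      case (elim T)
      have "ln (real T) powr 1 \<le> ln (real T) powr (1 + \<sigma>)"
        using elim(1) assms by (intro powr_mono) auto
      then have "z / c \<le> ln (real T) powr (1 + \<sigma>)" using elim by simp
      then show ?case using elim(3) assms by (simp add: field_simps)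
    qed
  qed
qed

theorem corollary1:
  fixes \<sigma> :: real
    and m :: "nat \<Rightarrow> nat"
    and b :: "nat \<Rightarrow> real ^ 'd"
    and D :: "nat \<Rightarrow> ('d::finite) item measure"
    and U :: "'u measure"
    and sol :: "('d, 'u) solver"
  assumes "0 < \<sigma>"
    and "\<And>T. 1 \<le> T \<Longrightarrow> allocation_instance (m T) (b T) (D T)"
    and "\<exists>c>0. \<forall>\<^sub>F T in sequentially.
           ereal (c * ln (real T) powr (1 + \<sigma>)) \<le> capacity_scale (m T) (b T) (D T)"
    and "exact_solver U sol"
    and "equivariant U sol"
  shows "\<exists>\<epsilon> :: nat \<Rightarrow> real. \<epsilon> \<longlonglongrightarrow> 0 \<and>
           (\<forall>\<^sub>F T in sequentially.
              expected_OSO U sol (m T) (b T) (D T) T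
                \<ge> (1 - \<epsilon> T) * expected_OPT (m T) (b T) (D T) T)"
proof -
  obtain c where c: "0 < c" and scale: "\<forall>\<^sub>F T in sequentially.
      ereal (c * ln (real T) powr (1 + \<sigma>)) \<le> capacity_scale (m T) (b T) (D T)"
    using assms(3) by blast
  define N where "N T = min (c * ln (real T) powr (1 + \<sigma>)) (real T)" for T
  \<comment> \<open>The value of \<open>3\<delta> + 2(d + 1)/(N\<delta>\<^sup>4)\<close> at \<open>\<delta> = N\<^sup>-\<^sup>1\<^sup>/\<^sup>5\<close>, where both terms have the same order.\<close>
  define \<epsilon> where "\<epsilon> T = (2 * real CARD('d) + 5) * N T powr (- 1 / 5)" for T
  have N: "filterlim N at_top sequentially"
    unfolding N_def by (rule filterlim_log_power[OF c assms(1)])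
  have "(\<lambda>T. N T powr (- 1 / 5)) \<longlonglongrightarrow> 0"
    by (rule tendsto_neg_powr[OF _ N]) simp
  from tendsto_mult_left[OF this] have lim: "\<epsilon> \<longlonglongrightarrow> 0"
    unfolding \<epsilon>_def by simp
  have "\<forall>\<^sub>F T in sequentially. \<epsilon> T < 1"
    by (rule order_tendstoD(2)[OF lim]) simp
  moreover have "\<forall>\<^sub>F T in sequentially. 1 \<le> N T"
    using N by (simp add: filterlim_at_top)
  ultimately have "\<forall>\<^sub>F T in sequentially. (1 - \<epsilon> T) * expected_OPT (m T) (b T) (D T) T
      \<le> expected_OSO U sol (m T) (b T) (D T) T"
    using scale eventually_ge_at_top[of 1]
  proof eventually_elim
    case (elim T)
    have inst: "allocation_instance (m T) (b T) (D T)" by (rule assms(2)[OF elim(4)])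
    then have b: "b T \<in> capacities" and prob: "prob_space (D T)"
      and sets: "sets (D T) = sets (item_space (m T))"
      and int: "\<And>j. j < m T \<Longrightarrow> integrable (D T) (\<lambda>\<xi>. fst \<xi> j)"
      by (auto simp: allocation_instance_def capacities_def)
    have space: "space (D T) = items (m T)"
      using sets_eq_imp_space_eq[OF sets] by (simp add: item_space_def space_restrict_space)
    let ?L = "c * ln (real T) powr (1 + \<sigma>)"
    have NL: "N T \<le> ?L" "N T \<le> real T" by (simp_all add: N_def)
    with elim(2) have "0 < ?L" by linarith
    from small_of_capacity_scale[OF inst this elim(3)]
    have small: "AE \<xi> in D T. \<forall>j<m T. \<forall>k. N T * snd \<xi> j $ k \<le> b T $ k"
      using AE_space
    proof eventually_elim
      case (elim \<xi>)
      show ?case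
      proof (intro allI impI)
        fix j k assume j: "j < m T"
        then have "0 \<le> snd \<xi> j $ k" using elim(2) by (auto simp: space items_def)
        then have "N T * snd \<xi> j $ k \<le> ?L * snd \<xi> j $ k" using NL(1) by (rule mult_right_mono[rotated])
        also have "\<dots> \<le> b T $ k" using elim(1) j by blast
        finally show "N T * snd \<xi> j $ k \<le> b T $ k" .
      qed
    qed
    have N_pos: "0 < N T" using elim(2) by linarith
    interpret online_allocation "m T" "b T" "D T" U sol "N T"
      by (rule online_allocation.intro[OF b prob sets int assms(4,5) N_pos small])
    define \<delta> where "\<delta> = N T powr (- 1 / 5)"
    have \<delta>: "0 < \<delta>" unfolding \<delta>_def using N_pos by simp
    have "1 / (N T * \<delta> ^ 4) = \<delta>"
    proof -
      have "N T * \<delta> ^ 4 = N T powr 1 * N T powr (- 4 / 5)"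
        unfolding \<delta>_def using N_pos by (simp add: powr_realpow[symmetric] powr_powr)
      also have "\<dots> = N T powr (1 / 5)" unfolding powr_add[symmetric] by simp
      finally show ?thesis by (simp add: \<delta>_def powr_minus_divide)
    qed
    then have "3 * \<delta> + 2 * (real CARD('d) + 1) * (1 / (N T * \<delta> ^ 4)) = \<epsilon> T"
      by (simp add: \<epsilon>_def \<delta>_def algebra_simps)
    then have eps: "3 * \<delta> + 2 * (real CARD('d) + 1) / (N T * \<delta> ^ 4) = \<epsilon> T"
      by simp
    show ?case
      using competitive_ratio[OF elim(4) NL(2) \<delta>] elim(1) unfolding eps by simp
  qed
  with lim show ?thesis by blast
qed

end
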